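(* Let $X$ be an algebraically discrete median algebra (every interval $[u,v]$ in $X$ is finite). Then, for the topological median algebra $(X,\tau_{\mathrm m})$, the minimal median compactification (MMC) $X\to\widehat X$ is the unique proper median compactification (up to isomorphism of compactifications), and it is canonically isomorphic to the classical Roller compactification $X\to X^R$.
   Context: A median algebra is a set $X$ with a ternary operation $m\colon X^3\to X$ that is symmetric in all variables and satisfies $m(a,b,b)=b$ and $m(m(a,x,b),x,c)=m(a,x,m(b,x,c))$. Intervals: $[x,y]=\{z: m(x,y,z)=z\}$. A subset $C$ is convex if $[x,y]\subseteq C$ for all $x,y\in C$. A subalgebra is a chain if it carries a linear order $\le$ for which $m(a,b,c)=b$ whenever $a\le b\le c$. Branches: $B^u_v=\{x: m(u,x,v)\neq v\}$. The median uniformity $\mathcal U_{\mathrm m}$ is the covering uniformity with uniform subbase all two-member covers $\{B^u_v,B^v_u\}$, where $[u,v]$ runs over all chain intervals with $u\neq v$: a cover belongs to $\mathcal U_{\mathrm m}$ iff it is refined by a finite common refinement of such covers. Its topology is $\tau_{\mathrm m}$. For algebraically discrete $X$ this uniformity is Hausdorff; the MMC $\widehat X$ is the Hausdorff completion of $(X,\mathcal U_{\mathrm m})$, a compact Hausdorff topological median algebra with the unique continuous extension of $m$. A median compactification of a topological median algebra $X$ is a pair $(K,\eta)$ where $K$ is a compact Hausdorff topological median algebra (continuous median operation) and $\eta\colon X\to K$ is a continuous median-preserving map with dense image; it is proper if $\eta$ is a topological embedding. An isomorphism of compactifications is a homeomorphic median isomorphism commuting with the maps from $X$. A halfspace of $X$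 is a nonempty convex proper subset with convex complement; $\mathcal H(X)$ is the set of all halfspaces. The Roller compactification is $\iota\colon X\to X^R$, where $\iota(x)=(\chi_H(x))_{H\in\mathcal H(X)}\in\{0,1\}^{\mathcal H(X)}$ and $X^R$ is the closure of $\iota(X)$ in the product space $\{0,1\}^{\mathcal H(X)}$ (with the coordinatewise median). *)

theory Defs
  imports "HOL-Analysis.Analysis"
begin

section \<open>Median algebras\<close>

definition median_algebra :: "'a set \<Rightarrow> ('a \<Rightarrow> 'a \<Rightarrow> 'a \<Rightarrow> 'a) \<Rightarrow> bool" where
  "median_algebra X m \<longleftrightarrow>
     (\<forall>a\<in>X. \<forall>b\<in>X. \<forall>c\<in>X. m a b c \<in> X) \<and>
     (\<forall>a\<in>X. \<forall>b\<in>X. \<forall>c\<in>X. m a b c = m b a c \<and> m a b c = m a c b) \<and>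
     (\<forall>a\<in>X. \<forall>b\<in>X. m a b b = b) \<and>
     (\<forall>a\<in>X. \<forall>b\<in>X. \<forall>c\<in>X. \<forall>x\<in>X. m (m a x b) x c = m a x (m b x c))"

definition median_interval :: "'a set \<Rightarrow> ('a \<Rightarrow> 'a \<Rightarrow> 'a \<Rightarrow> 'a) \<Rightarrow> 'a \<Rightarrow> 'a \<Rightarrow> 'a set" where
  "median_interval X m x y = {z \<in> X. m x y z = z}"

definition algebraically_discrete :: "'a set \<Rightarrow> ('a \<Rightarrow> 'a \<Rightarrow> 'a \<Rightarrow> 'a) \<Rightarrow> bool" where
  "algebraically_discrete X m \<longleftrightarrow> (\<forall>u\<in>X. \<forall>v\<in>X. finite (median_interval X m u v))"

definition median_convex :: "'a set \<Rightarrow> ('a \<Rightarrow> 'a \<Rightarrow> 'a \<Rightarrow> 'a) \<Rightarrow> 'a set \<Rightarrow> bool" where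
  "median_convex X m C \<longleftrightarrow> C \<subseteq> X \<and> (\<forall>x\<in>C. \<forall>y\<in>C. median_interval X m x y \<subseteq> C)"

definition halfspaces :: "'a set \<Rightarrow> ('a \<Rightarrow> 'a \<Rightarrow> 'a \<Rightarrow> 'a) \<Rightarrow> 'a set set" where
  "halfspaces X m =
     {H. H \<noteq> {} \<and> H \<subset> X \<and> median_convex X m H \<and> median_convex X m (X - H)}"

definition median_subalgebra :: "'a set \<Rightarrow> ('a \<Rightarrow> 'a \<Rightarrow> 'a \<Rightarrow> 'a) \<Rightarrow> 'a set \<Rightarrow> bool" where
  "median_subalgebra X m C \<longleftrightarrow> C \<subseteq> X \<and> (\<forall>a\<in>C. \<forall>b\<in>C. \<forall>c\<in>C. m a b c \<in> C)"

definition median_chain :: "'a set \<Rightarrow> ('a \<Rightarrow> 'a \<Rightarrow> 'a \<Rightarrow> 'a) \<Rightarrow> 'a set \<Rightarrow> bool" where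
  "median_chain X m C \<longleftrightarrow> median_subalgebra X m C \<and>
     (\<exists>r. linear_order_on C r \<and>
          (\<forall>a\<in>C. \<forall>b\<in>C. \<forall>c\<in>C. (a, b) \<in> r \<and> (b, c) \<in> r \<longrightarrow> m a b c = b))"

definition branch :: "'a set \<Rightarrow> ('a \<Rightarrow> 'a \<Rightarrow> 'a \<Rightarrow> 'a) \<Rightarrow> 'a \<Rightarrow> 'a \<Rightarrow> 'a set" where
  "branch X m u v = {x \<in> X. m u x v \<noteq> v}"

section \<open>Covering uniformities and their completion\<close>

definition is_cover :: "'a set \<Rightarrow> 'a set set \<Rightarrow> bool" where
  "is_cover X C \<longleftrightarrow> C \<subseteq> Pow X \<and> \<Union>C = X"

definition refines :: "'a set set \<Rightarrow> 'a set set \<Rightarrow> bool" where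
  "refines D C \<longleftrightarrow> (\<forall>d\<in>D. \<exists>c\<in>C. d \<subseteq> c)"

text \<open>The coarsest common refinement of a family \<open>S\<close> of covers; it is \<open>{X}\<close> when \<open>S\<close> is empty.\<close>

definition common_refinement :: "'a set \<Rightarrow> 'a set set set \<Rightarrow> 'a set set" where
  "common_refinement X S = {X \<inter> (\<Inter>C\<in>S. f C) | f. \<forall>C\<in>S. f C \<in> C}"

definition uniformity_from_subbase :: "'a set \<Rightarrow> 'a set set set \<Rightarrow> 'a set set set" where
  "uniformity_from_subbase X B =
     {C. is_cover X C \<and> (\<exists>S. finite S \<and> S \<subseteq> B \<and> refines (common_refinement X S) C)}"

definition cover_star :: "'a set set \<Rightarrow> 'a \<Rightarrow> 'a set" where
  "cover_star C x = \<Union>{c \<in> C. x \<in> c}"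

definition uniform_topology :: "'a set \<Rightarrow> 'a set set set \<Rightarrow> 'a topology" where
  "uniform_topology X U =
     topology (\<lambda>W. W \<subseteq> X \<and> (\<forall>x\<in>W. \<exists>C\<in>U. cover_star C x \<subseteq> W))"

text \<open>The Hausdorff completion is Bourbaki's: its points are the minimal Cauchy filters on \<open>X\<close>, the
  canonical map sends a point to its neighbourhood filter, and a base of the uniformity is given by
  the covers \<open>{{F. c \<in> F} | c \<in> C}\<close> with \<open>C\<close> uniform. Filters on \<open>X\<close> are filters on the ambient
  type that contain \<open>X\<close>; the order on filters in the library is reverse inclusion, so minimal Cauchy
  filters are the maximal ones for it.\<close>

definition cauchy_on :: "'a set \<Rightarrow> 'a set set set \<Rightarrow> 'a filter \<Rightarrow> bool" where
  "cauchy_on X U F \<longleftrightarrow> F \<noteq> bot \<and> eventually (\<lambda>x. x \<in> X) F \<and>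
     (\<forall>C\<in>U. \<exists>c\<in>C. eventually (\<lambda>x. x \<in> c) F)"

definition completion_points :: "'a set \<Rightarrow> 'a set set set \<Rightarrow> 'a filter set" where
  "completion_points X U = {F. cauchy_on X U F \<and> (\<forall>G. cauchy_on X U G \<and> F \<le> G \<longrightarrow> G = F)}"

definition completion_uniformity :: "'a set \<Rightarrow> 'a set set set \<Rightarrow> 'a filter set set set" where
  "completion_uniformity X U =
     {D. is_cover (completion_points X U) D \<and>
         (\<exists>C\<in>U. refines ((\<lambda>c. {F \<in> completion_points X U. eventually (\<lambda>x. x \<in> c) F}) ` C) D)}"

definition completion_space :: "'a set \<Rightarrow> 'a set set set \<Rightarrow> 'a filter topology" where
  "completion_space X U = uniform_topology (completion_points X U) (completion_uniformity X U)"

definition completion_map :: "'a set \<Rightarrow> 'a set set set \<Rightarrow> 'a \<Rightarrow> 'a filter" where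
  "completion_map X U x = nhdsin (uniform_topology X U) x"

section \<open>The median uniformity and the minimal median compactification\<close>

definition median_uniformity :: "'a set \<Rightarrow> ('a \<Rightarrow> 'a \<Rightarrow> 'a \<Rightarrow> 'a) \<Rightarrow> 'a set set set" where
  "median_uniformity X m = uniformity_from_subbase X
     {{branch X m u v, branch X m v u} | u v.
        u \<in> X \<and> v \<in> X \<and> u \<noteq> v \<and> median_chain X m (median_interval X m u v)}"

definition median_topology :: "'a set \<Rightarrow> ('a \<Rightarrow> 'a \<Rightarrow> 'a \<Rightarrow> 'a) \<Rightarrow> 'a topology" where
  "median_topology X m = uniform_topology X (median_uniformity X m)"

definition mmc_space :: "'a set \<Rightarrow> ('a \<Rightarrow> 'a \<Rightarrow> 'a \<Rightarrow> 'a) \<Rightarrow> 'a filter topology" where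
  "mmc_space X m = completion_space X (median_uniformity X m)"

definition mmc_map :: "'a set \<Rightarrow> ('a \<Rightarrow> 'a \<Rightarrow> 'a \<Rightarrow> 'a) \<Rightarrow> 'a \<Rightarrow> 'a filter" where
  "mmc_map X m = completion_map X (median_uniformity X m)"

definition continuous_ternary :: "'a topology \<Rightarrow> ('a \<Rightarrow> 'a \<Rightarrow> 'a \<Rightarrow> 'a) \<Rightarrow> bool" where
  "continuous_ternary T m \<longleftrightarrow>
     continuous_map (prod_topology T (prod_topology T T)) T (\<lambda>(a, b, c). m a b c)"

text \<open>The continuous extension of \<open>m\<close>. It is determined on the space itself, since the image of \<open>X\<close>
  is dense in a Hausdorff space; its values elsewhere on the type are irrelevant.\<close>

definition mmc_median ::
    "'a set \<Rightarrow> ('a \<Rightarrow> 'a \<Rightarrow> 'a \<Rightarrow> 'a) \<Rightarrow> 'a filter \<Rightarrow> 'a filter \<Rightarrow> 'a filter \<Rightarrow> 'a filter" where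
  "mmc_median X m = (SOME M. continuous_ternary (mmc_space X m) M \<and>
     (\<forall>a\<in>X. \<forall>b\<in>X. \<forall>c\<in>X.
        M (mmc_map X m a) (mmc_map X m b) (mmc_map X m c) = mmc_map X m (m a b c)))"

section \<open>Median compactifications\<close>

definition topological_median_algebra :: "'a topology \<Rightarrow> ('a \<Rightarrow> 'a \<Rightarrow> 'a \<Rightarrow> 'a) \<Rightarrow> bool" where
  "topological_median_algebra T m \<longleftrightarrow> median_algebra (topspace T) m \<and> continuous_ternary T m"

definition median_preserving ::
    "'a set \<Rightarrow> ('a \<Rightarrow> 'a \<Rightarrow> 'a \<Rightarrow> 'a) \<Rightarrow> ('b \<Rightarrow> 'b \<Rightarrow> 'b \<Rightarrow> 'b) \<Rightarrow> ('a \<Rightarrow> 'b) \<Rightarrow> bool" where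
  "median_preserving X m n f \<longleftrightarrow> (\<forall>a\<in>X. \<forall>b\<in>X. \<forall>c\<in>X. f (m a b c) = n (f a) (f b) (f c))"

definition median_compactification ::
    "'a topology \<Rightarrow> ('a \<Rightarrow> 'a \<Rightarrow> 'a \<Rightarrow> 'a) \<Rightarrow>
     'k topology \<Rightarrow> ('k \<Rightarrow> 'k \<Rightarrow> 'k \<Rightarrow> 'k) \<Rightarrow> ('a \<Rightarrow> 'k) \<Rightarrow> bool" where
  "median_compactification T m K n \<eta> \<longleftrightarrow>
     topological_median_algebra T m \<and>
     topological_median_algebra K n \<and> compact_space K \<and> Hausdorff_space K \<and>
     continuous_map T K \<eta> \<and> median_preserving (topspace T) m n \<eta> \<and>
     K closure_of (\<eta> ` topspace T) = topspace K"

definition proper_median_compactification ::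
    "'a topology \<Rightarrow> ('a \<Rightarrow> 'a \<Rightarrow> 'a \<Rightarrow> 'a) \<Rightarrow>
     'k topology \<Rightarrow> ('k \<Rightarrow> 'k \<Rightarrow> 'k \<Rightarrow> 'k) \<Rightarrow> ('a \<Rightarrow> 'k) \<Rightarrow> bool" where
  "proper_median_compactification T m K n \<eta> \<longleftrightarrow>
     median_compactification T m K n \<eta> \<and> embedding_map T K \<eta>"

definition isomorphic_compactifications ::
    "'a topology \<Rightarrow> ('a \<Rightarrow> 'a \<Rightarrow> 'a \<Rightarrow> 'a) \<Rightarrow>
     'k topology \<Rightarrow> ('k \<Rightarrow> 'k \<Rightarrow> 'k \<Rightarrow> 'k) \<Rightarrow> ('a \<Rightarrow> 'k) \<Rightarrow>
     'l topology \<Rightarrow> ('l \<Rightarrow> 'l \<Rightarrow> 'l \<Rightarrow> 'l) \<Rightarrow> ('a \<Rightarrow> 'l) \<Rightarrow> bool" where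
  "isomorphic_compactifications T m K n \<eta> L p \<theta> \<longleftrightarrow>
     median_compactification T m K n \<eta> \<and> median_compactification T m L p \<theta> \<and>
     (\<exists>f. homeomorphic_map K L f \<and> median_preserving (topspace K) n p f \<and>
          (\<forall>x\<in>topspace T. f (\<eta> x) = \<theta> x))"

section \<open>The Roller compactification\<close>

text \<open>The two-point space \<open>{0,1}\<close> is rendered by \<open>bool\<close>, so that \<open>\<chi>\<^sub>H(x)\<close> is \<open>x \<in> H\<close> and the
  median of \<open>{0,1}\<close> is the majority function.\<close>

definition roller_cube ::
    "'a set \<Rightarrow> ('a \<Rightarrow> 'a \<Rightarrow> 'a \<Rightarrow> 'a) \<Rightarrow> ('a set \<Rightarrow> bool) topology" where
  "roller_cube X m = product_topology (\<lambda>_. discrete_topology UNIV) (halfspaces X m)"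

definition roller_map :: "'a set \<Rightarrow> ('a \<Rightarrow> 'a \<Rightarrow> 'a \<Rightarrow> 'a) \<Rightarrow> 'a \<Rightarrow> 'a set \<Rightarrow> bool" where
  "roller_map X m x = (\<lambda>H\<in>halfspaces X m. x \<in> H)"

definition roller_space ::
    "'a set \<Rightarrow> ('a \<Rightarrow> 'a \<Rightarrow> 'a \<Rightarrow> 'a) \<Rightarrow> ('a set \<Rightarrow> bool) topology" where
  "roller_space X m =
     subtopology (roller_cube X m) (roller_cube X m closure_of (roller_map X m ` X))"

definition majority :: "bool \<Rightarrow> bool \<Rightarrow> bool \<Rightarrow> bool" where
  "majority a b c \<longleftrightarrow> (a \<and> b) \<or> (b \<and> c) \<or> (a \<and> c)"

definition roller_median :: "'a set \<Rightarrow> ('a \<Rightarrow> 'a \<Rightarrow> 'a \<Rightarrow> 'a) \<Rightarrow>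
    ('a set \<Rightarrow> bool) \<Rightarrow> ('a set \<Rightarrow> bool) \<Rightarrow> ('a set \<Rightarrow> bool) \<Rightarrow> 'a set \<Rightarrow> bool" where
  "roller_median X m p q r = (\<lambda>H\<in>halfspaces X m. majority (p H) (q H) (r H))"

end

theory Submission
  imports Defs
begin

text \<open>
  In an algebraically discrete median algebra every interval \<open>[u,v]\<close> with \<open>u \<noteq> v\<close> contains a point adjacent to
  \<open>v\<close>, that is, a point \<open>w\<close> with \<open>[w,v] = {w, v}\<close> and \<open>w \<noteq> v\<close>. For adjacent \<open>u\<close> and \<open>v\<close> the map \<open>x \<mapsto> m u x v\<close> sorts \<open>X\<close> into two
  complementary halfspaces (\<open>adjacent_halfspace\<close>, which rests on the gate property of intervals,
  \<open>median_gate\<close>), and every halfspace arises in this way (\<open>halfspace_from_adjacent\<close>). Consequently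
  halfspaces separate points, and the median uniformity is generated by the partitions
  \<open>{H, X - H}\<close> by halfspaces (\<open>median_uniformity_halfspaces\<close>).

  For any family \<open>\<H>\<close> of subsets of \<open>X\<close>, a proper filter on \<open>X\<close> is Cauchy for the uniformity generated by the partitions
  \<open>{H, X - H}\<close> precisely if it decides every \<open>H\<close>, and a minimal Cauchy filter is determined by its
  decisions. This identifies the completion with the closure of the image of \<open>X\<close> in the cube over \<open>\<H>\<close>
  (\<open>completion_space_partition_homeomorphic\<close>). For halfspaces this closure is the Roller
  compactification, and the extended median is carried along by density
  (\<open>mmc_isomorphic_roller\<close>).

  For uniqueness let \<open>\<eta>\<close> be a proper median compactification of \<open>X\<close> in \<open>K\<close> with median \<open>n\<close>. The closures of \<open>\<eta> ` H\<close>
  and \<open>\<eta> ` (X - H)\<close> partition \<open>K\<close> (\<open>closure_of_halfspace_complement\<close>), which yields a continuous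
  homomorphism from \<open>K\<close> onto the Roller compactification. If it identifies \<open>p\<close> and \<open>q\<close>, then
  \<open>n a b p = n a b q\<close> for \<open>a\<close> and \<open>b\<close> in the image of \<open>X\<close>, because these values lie in finite
  intervals of \<open>X\<close>, where halfspaces separate; by density the same holds on all of \<open>K\<close>, and
  \<open>p = n p q p = n p q q = q\<close> (\<open>proper_median_compactification_unique\<close>). A continuous bijection from
  a compact space onto a Hausdorff space is a homeomorphism.
\<close>

section \<open>Halfspaces of algebraically discrete median algebras\<close>

lemma
  assumes "median_algebra X m"
  shows median_closed: "\<And>a b c. \<lbrakk>a \<in> X; b \<in> X; c \<in> X\<rbrakk> \<Longrightarrow> m a b c \<in> X"
    and median_swap12: "\<And>a b c. \<lbrakk>a \<in> X; b \<in> X; c \<in> X\<rbrakk> \<Longrightarrow> m a b c = m b a c"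
    and median_swap23: "\<And>a b c. \<lbrakk>a \<in> X; b \<in> X; c \<in> X\<rbrakk> \<Longrightarrow> m a b c = m a c b"
    and median_swap13: "\<And>a b c. \<lbrakk>a \<in> X; b \<in> X; c \<in> X\<rbrakk> \<Longrightarrow> m a b c = m c b a"
    and median_repeated: "\<And>a b. \<lbrakk>a \<in> X; b \<in> X\<rbrakk> \<Longrightarrow> m a b b = b"
    and median_repeated': "\<And>a b. \<lbrakk>a \<in> X; b \<in> X\<rbrakk> \<Longrightarrow> m a a b = a"
    and median_repeated'': "\<And>a b. \<lbrakk>a \<in> X; b \<in> X\<rbrakk> \<Longrightarrow> m a b a = a"
    and median_assoc: "\<And>a b c x. \<lbrakk>a \<in> X; b \<in> X; c \<in> X; x \<in> X\<rbrakk> \<Longrightarrow>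
      m a x (m b x c) = m (m a x b) x c"
proof -
  have sym: "m a b c = m b a c \<and> m a b c = m a c b" if "a \<in> X" "b \<in> X" "c \<in> X" for a b c
    using assms that unfolding median_algebra_def by blast
  have rep: "m a b b = b" if "a \<in> X" "b \<in> X" for a b
    using assms that unfolding median_algebra_def by blast
  show "m a b c = m b a c" "m a b c = m a c b" "m a b c = m c b a"
    if "a \<in> X" "b \<in> X" "c \<in> X" for a b c
    using sym that by metis+
  show "m a b b = b" "m a a b = a" "m a b a = a" if "a \<in> X" "b \<in> X" for a b
    using rep sym that by metis+
  show "m a b c \<in> X" if "a \<in> X" "b \<in> X" "c \<in> X" for a b c
    using assms that unfolding median_algebra_def by blast
  show "m a x (m b x c) = m (m a x b) x c" if "a \<in> X" "b \<in> X" "c \<in> X" "x \<in> X" for a b c x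
    using assms that unfolding median_algebra_def by metis
qed

text \<open>The operation \<open>a, b \<mapsto> m q a b\<close> is a meet for which \<open>q\<close> is least. In this order
  \<open>m q x y\<close> lies below every point of \<open>[x,y]\<close>: it is the gate of \<open>q\<close> in this interval. Associativity
  with pivot \<open>x\<close> turns \<open>m q x z\<close> into \<open>m p x z\<close>, which is visibly above \<open>p\<close>.\<close>

lemma median_gate:
  assumes M: "median_algebra X m" and in_X: "q \<in> X" "x \<in> X" "y \<in> X" "z \<in> X"
    and z: "m x y z = z"
  shows "m q z (m q x y) = m q x y"
proof -
  note M_simps = in_X median_closed[OF M]
  define p where "p = m q x y"
  have p: "p \<in> X"
    using M_simps by (simp add: p_def)
  have "m q x p = m (m q x q) x y"
    using in_X median_assoc[OF M, of q q y x] by (simp add: p_def)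
  hence "m q x p = p"
    using in_X median_repeated''[OF M] by (simp add: p_def)
  hence qx: "m p q x = p" "m q p x = p"
    using in_X p median_swap13[OF M, of p q x] median_swap12[OF M, of x q p]
      median_swap23[OF M, of q p x] by simp_all
  have "m q x z = m q x (m y x z)"
    using z M_simps median_swap12[OF M, of x y z] by simp
  also have "\<dots> = m p x z"
    using M_simps median_assoc[OF M, of q y z x] median_swap23[OF M, of q x y] by (simp add: p_def)
  finally have "m q x z = m p x z" .
  hence "m p q (m x q z) = m q p (m x p z)"
    using M_simps p median_swap12[OF M] by metis
  moreover have "m p q (m x q z) = m p q z"
    using M_simps p median_assoc[OF M, of p x z q] qx by simp
  moreover have "m q p (m x p z) = p"
    using M_simps p median_assoc[OF M, of q x z p] qx median_repeated'[OF M] by simp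
  ultimately have "m p q z = p" by simp
  thus ?thesis
    using M_simps p median_swap12[OF M] median_swap23[OF M] by (metis p_def)
qed

text \<open>In the order with least element \<open>v\<close> this is the set of points above \<open>u\<close>. If \<open>x\<close> and \<open>y\<close> are
  above \<open>u\<close>, then so is their meet, and the meet is below all of \<open>[x,y]\<close> by the gate property.\<close>

lemma median_convex_upset:
  assumes M: "median_algebra X m" and uv: "u \<in> X" "v \<in> X"
  shows "median_convex X m {x \<in> X. m v x u = u}"
  unfolding median_convex_def
proof (intro conjI ballI subsetI)
  fix x y z
  assume x: "x \<in> {x \<in> X. m v x u = u}" and y: "y \<in> {x \<in> X. m v x u = u}"
    and z: "z \<in> median_interval X m x y"
  define p where "p = m v x y"
  have in_X: "x \<in> X" "y \<in> X" "z \<in> X" "p \<in> X"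
    using x y z uv median_closed[OF M] by (auto simp: median_interval_def p_def)
  have zp: "m z v p = p"
    using median_gate[OF M, of v x y z] z in_X uv median_swap12[OF M, of z v p]
    by (simp add: p_def median_interval_def)
  have "m u v p = m u v (m x v y)"
    using in_X uv median_swap12[OF M] by (simp add: p_def)
  also have "\<dots> = m (m u v x) v y"
    using in_X uv median_assoc[OF M] by simp
  also have "\<dots> = u"
    using in_X uv x y median_swap12[OF M, of u v] median_swap23[OF M, of v u] by simp
  finally have "m p v u = u"
    using median_swap13[OF M] uv in_X by metis
  hence "m z v u = m (m z v p) v u"
    using zp median_assoc[OF M, of z p u v] in_X uv by simp
  hence "m z v u = u"
    using zp \<open>m p v u = u\<close> by simp
  thus "z \<in> {x \<in> X. m v x u = u}"
    using in_X uv median_swap12[OF M] by simp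
qed auto

lemma median_mem_interval:
  assumes M: "median_algebra X m" and "u \<in> X" "v \<in> X" "x \<in> X"
  shows "m u x v \<in> median_interval X m u v"
proof -
  have "m u v (m u x v) = m u v (m u v x)"
    using assms median_swap23[OF M] by metis
  also have "\<dots> = m u x v"
    using assms median_assoc[OF M, of u u x v] median_swap12[OF M] median_swap23[OF M]
      median_repeated''[OF M] median_closed[OF M] by metis
  finally show ?thesis
    using assms median_closed[OF M] by (simp add: median_interval_def)
qed

lemma median_interval_commute:
  assumes "median_algebra X m" "u \<in> X" "v \<in> X"
  shows "median_interval X m u v = median_interval X m v u"
  using median_swap12[OF assms, of _] unfolding median_interval_def
  by (intro Collect_cong conj_cong) simp_all

lemma endpoints_mem_interval:
  assumes "median_algebra X m" "u \<in> X" "v \<in> X"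
  shows "u \<in> median_interval X m u v" "v \<in> median_interval X m u v"
  using assms median_repeated[OF assms] median_repeated''[OF assms]
  by (simp_all add: median_interval_def)

lemma median_interval_psubset:
  assumes M: "median_algebra X m" and uv: "u \<in> X" "v \<in> X"
    and z: "z \<in> median_interval X m u v" "z \<noteq> u"
  shows "median_interval X m z v \<subset> median_interval X m u v"
proof
  have z': "z \<in> X" "m u v z = z"
    using z by (auto simp: median_interval_def)
  show "median_interval X m z v \<subseteq> median_interval X m u v"
  proof
    fix w assume w: "w \<in> median_interval X m z v"
    hence "w \<in> X" "m u v w = m u v (m z v w)"
      by (auto simp: median_interval_def)
    note this(2)
    also have "m u v (m z v w) = w"
      using w z' uv median_assoc[OF M, of u z w v] by (simp add: median_interval_def)
    finally show "w \<in> median_interval X m u v"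
      using \<open>w \<in> X\<close> by (simp add: median_interval_def)
  qed
  have "u \<notin> median_interval X m z v"
    using z' z uv median_swap13[OF M, of u v z] median_swap12[OF M, of z v u]
      median_swap23[OF M, of v z u]
    by (auto simp: median_interval_def)
  thus "median_interval X m z v \<noteq> median_interval X m u v"
    using endpoints_mem_interval[OF M uv] by blast
qed

definition adjacent :: "'a set \<Rightarrow> ('a \<Rightarrow> 'a \<Rightarrow> 'a \<Rightarrow> 'a) \<Rightarrow> 'a \<Rightarrow> 'a \<Rightarrow> bool" where
  "adjacent X m u v \<longleftrightarrow> u \<in> X \<and> v \<in> X \<and> u \<noteq> v \<and> median_interval X m u v = {u, v}"

lemma adjacent_commute: "median_algebra X m \<Longrightarrow> adjacent X m u v \<Longrightarrow> adjacent X m v u"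
  using median_interval_commute[of X m u v] by (auto simp: adjacent_def)

lemma adjacent_complement:
  assumes M: "median_algebra X m" and "adjacent X m u v"
  shows "X - {x \<in> X. m u x v = u} = {x \<in> X. m v x u = v}"
proof -
  have "m v x u = m u x v" "m u x v \<in> {u, v}" if "x \<in> X" for x
    using assms that median_swap13[OF M] median_mem_interval[OF M, of u v x]
    by (auto simp: adjacent_def)
  moreover have "u \<noteq> v"
    using assms(2) by (simp add: adjacent_def)
  ultimately show ?thesis
    by fastforce
qed

text \<open>The map \<open>x \<mapsto> m u x v\<close> retracts \<open>X\<close> onto \<open>{u, v}\<close>. Its fibres are the points above \<open>u\<close> seen from
  \<open>v\<close> and the points above \<open>v\<close> seen from \<open>u\<close>, so both are convex.\<close>

lemma adjacent_halfspace:
  assumes M: "median_algebra X m" and adj: "adjacent X m u v"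
  shows "{x \<in> X. m u x v = u} \<in> halfspaces X m"
proof -
  have convex: "median_convex X m {x \<in> X. m u x v = u}" if "adjacent X m u v" for u v
  proof -
    have "{x \<in> X. m u x v = u} = {x \<in> X. m v x u = u}"
      by (rule Collect_cong) (use that median_swap13[OF M, of u _ v] in \<open>auto simp: adjacent_def\<close>)
    thus ?thesis
      using median_convex_upset[OF M] that by (simp add: adjacent_def)
  qed
  have "u \<in> {x \<in> X. m u x v = u}" "v \<in> {x \<in> X. m v x u = v}"
    using adj median_repeated'[OF M] by (auto simp: adjacent_def)
  hence "{x \<in> X. m u x v = u} \<noteq> {}" "{x \<in> X. m u x v = u} \<noteq> X"
    using adjacent_complement[OF M adj] by blast+
  moreover have "median_convex X m (X - {x \<in> X. m u x v = u})"
    unfolding adjacent_complement[OF M adj] by (rule convex[OF adjacent_commute[OF M adj]])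
  ultimately show ?thesis
    using convex[OF adj] unfolding halfspaces_def by blast
qed

text \<open>Here finiteness of intervals enters: among the points of \<open>[u,v]\<close> other than \<open>v\<close>, one with the
  smallest interval to \<open>v\<close> is adjacent to \<open>v\<close>.\<close>

lemma exists_adjacent_in_interval:
  assumes M: "median_algebra X m" and discrete: "algebraically_discrete X m"
    and uv: "u \<in> X" "v \<in> X" "u \<noteq> v"
  obtains w where "w \<in> median_interval X m u v" "adjacent X m w v"
proof -
  let ?I = "median_interval X m"
  obtain w where w: "w \<in> ?I u v" "w \<noteq> v"
    and min: "\<And>z. z \<in> ?I u v \<Longrightarrow> z \<noteq> v \<Longrightarrow> card (?I w v) \<le> card (?I z v)"
    using ex_has_least_nat[of "\<lambda>w. w \<in> ?I u v \<and> w \<noteq> v" u "\<lambda>w. card (?I w v)"]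
      endpoints_mem_interval[OF M uv(1,2)] uv(3) by blast
  have w_X: "w \<in> X"
    using w by (simp add: median_interval_def)
  have "?I w v \<subseteq> {w, v}"
  proof
    fix z assume z: "z \<in> ?I w v"
    show "z \<in> {w, v}"
    proof (rule ccontr)
      assume "z \<notin> {w, v}"
      hence less: "?I z v \<subset> ?I w v"
        using median_interval_psubset[OF M w_X uv(2) z] by blast
      have "finite (?I w v)"
        using discrete w_X uv by (simp add: algebraically_discrete_def)
      hence "card (?I z v) < card (?I w v)"
        using less psubset_card_mono by blast
      moreover have "z \<in> ?I u v"
        using z median_interval_psubset[OF M uv(1,2) w(1)] by (cases "w = u") auto
      ultimately show False
        using min[of z] \<open>z \<notin> {w, v}\<close> by auto
    qed
  qed
  hence "adjacent X m w v"
    using w w_X uv endpoints_mem_interval[OF M w_X uv(2)] by (auto simp: adjacent_def)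
  thus thesis
    using that w by blast
qed

lemma halfspaceD:
  assumes "H \<in> halfspaces X m"
  shows "H \<subseteq> X" "X - H \<in> halfspaces X m"
    "\<And>x y. \<lbrakk>x \<in> H; y \<in> H\<rbrakk> \<Longrightarrow> median_interval X m x y \<subseteq> H"
  using assms unfolding halfspaces_def median_convex_def
  by (auto simp: double_diff)

text \<open>A shortest interval \<open>[u,v]\<close> that leads from \<open>H\<close> to its complement has only its two endpoints.
  Since \<open>m u x v\<close> lies in \<open>[u,x]\<close> and in \<open>[v,x]\<close>, convexity of both sides puts it on the side
  of \<open>x\<close>.\<close>

lemma halfspace_from_adjacent:
  assumes M: "median_algebra X m" and discrete: "algebraically_discrete X m"
    and H: "H \<in> halfspaces X m"
  obtains u v where "adjacent X m u v" "H = {x \<in> X. m u x v = u}"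
proof -
  let ?I = "median_interval X m"
  obtain x y where "x \<in> H" "y \<in> X - H"
    using H unfolding halfspaces_def by blast
  then obtain u v where uv: "u \<in> H" "v \<in> X - H"
    and min: "\<And>x y. x \<in> H \<Longrightarrow> y \<in> X - H \<Longrightarrow> card (?I u v) \<le> card (?I x y)"
    using ex_has_least_nat[of "\<lambda>(u, v). u \<in> H \<and> v \<in> X - H" "(x, y)"
        "\<lambda>(u, v). card (?I u v)"] by auto
  have uv_X: "u \<in> X" "v \<in> X"
    using uv halfspaceD(1)[OF H] by auto
  have fin: "finite (?I u v)"
    using discrete uv_X by (simp add: algebraically_discrete_def)
  have "?I u v \<subseteq> {u, v}"
  proof
    fix z assume z: "z \<in> ?I u v"
    hence z': "z \<in> X" "z \<in> ?I v u"
      using median_interval_commute[OF M uv_X] by (auto simp: median_interval_def)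
    show "z \<in> {u, v}"
    proof (rule ccontr)
      assume "z \<notin> {u, v}"
      hence "?I z v \<subset> ?I u v" "?I u z \<subset> ?I u v"
        using median_interval_psubset[OF M uv_X z] median_interval_psubset[OF M uv_X(2,1) z'(2)]
          median_interval_commute[OF M] z' uv_X by auto
      hence "card (?I z v) < card (?I u v)" "card (?I u z) < card (?I u v)"
        using fin psubset_card_mono by blast+
      thus False
        using min[of z v] min[of u z] uv z' by (cases "z \<in> H") auto
    qed
  qed
  hence adj: "adjacent X m u v"
    using uv uv_X endpoints_mem_interval[OF M uv_X] by (auto simp: adjacent_def)
  have side: "m u x v = u \<longleftrightarrow> x \<in> H" if x: "x \<in> X" for x
  proof -
    have mem: "m u x v \<in> ?I u x" "m u x v \<in> ?I v x"
      using median_mem_interval[OF M uv_X(1) x uv_X(2)] median_mem_interval[OF M uv_X(2) x uv_X(1)]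
        median_swap23[OF M] median_swap12[OF M] x uv_X by metis+
    have "m u x v \<in> {u, v}"
      using median_mem_interval[OF M uv_X x] adj by (simp add: adjacent_def)
    moreover have "m u x v \<in> H" if "x \<in> H"
      using halfspaceD(3)[OF H uv(1) that] mem by blast
    moreover have "m u x v \<in> X - H" if "x \<notin> H"
      using halfspaceD(3)[OF halfspaceD(2)[OF H] uv(2), of x] that x mem by blast
    ultimately show ?thesis
      using uv by (cases "x \<in> H") auto
  qed
  show thesis
    by (rule that[OF adj]) (use side halfspaceD(1)[OF H] in blast)
qed

lemma halfspace_separation:
  assumes M: "median_algebra X m" and "algebraically_discrete X m"
    and xy: "x \<in> X" "y \<in> X" "x \<noteq> y"
  obtains H where "H \<in> halfspaces X m" "x \<in> H" "y \<notin> H"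
proof -
  obtain w where w: "w \<in> median_interval X m x y" "adjacent X m w y"
    using exists_adjacent_in_interval[OF assms] .
  hence "w \<in> X" "w \<noteq> y" "m x y w = w"
    by (simp_all add: median_interval_def adjacent_def)
  hence "m w x y = w" "m w y y = y" "w \<noteq> y"
    using xy median_swap13[OF M, of x y w] median_swap23[OF M, of w x y] median_repeated[OF M]
    by simp_all
  thus thesis
    using that[OF adjacent_halfspace[OF M w(2)]] xy by simp
qed

section \<open>Uniformities generated by two-set partitions\<close>

text \<open>The cube and the map of the Roller construction, for an arbitrary family \<open>\<H>\<close> of sets: the
  completion of a uniformity generated by two-set partitions is computed in this generality.\<close>

definition membership_cube :: "'a set set \<Rightarrow> ('a set \<Rightarrow> bool) topology" where
  "membership_cube \<H> = product_topology (\<lambda>_. discrete_topology UNIV) \<H>"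

definition membership_map :: "'a set set \<Rightarrow> 'a \<Rightarrow> 'a set \<Rightarrow> bool" where
  "membership_map \<H> x = (\<lambda>H\<in>\<H>. x \<in> H)"

lemma topspace_membership_cube: "topspace (membership_cube \<H>) = extensional \<H>"
  by (auto simp: membership_cube_def PiE_def)

lemma membership_map_in_cube: "membership_map \<H> x \<in> topspace (membership_cube \<H>)"
  by (simp add: membership_map_def topspace_membership_cube)

lemma openin_membership_cube:
  "openin (membership_cube \<H>) W \<longleftrightarrow> W \<subseteq> topspace (membership_cube \<H>) \<and>
     (\<forall>p\<in>W. \<exists>S. finite S \<and> S \<subseteq> \<H> \<and>
        {q \<in> topspace (membership_cube \<H>). \<forall>H\<in>S. q H = p H} \<subseteq> W)"
    (is "?open \<longleftrightarrow> ?nbhds")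
proof
  assume ?open
  have "\<exists>S. finite S \<and> S \<subseteq> \<H> \<and> {q \<in> topspace (membership_cube \<H>). \<forall>H\<in>S. q H = p H} \<subseteq> W"
    if "p \<in> W" for p
  proof -
    have basic: "\<forall>p\<in>W. \<exists>U. finite {H \<in> \<H>. U H \<noteq> (UNIV :: bool set)} \<and> p \<in> Pi\<^sub>E \<H> U \<and> Pi\<^sub>E \<H> U \<subseteq> W"
      using \<open>?open\<close> unfolding membership_cube_def openin_product_topology_alt by simp
    from bspec[OF basic that] obtain U
      where U: "finite {H \<in> \<H>. U H \<noteq> (UNIV :: bool set)}" "p \<in> Pi\<^sub>E \<H> U" "Pi\<^sub>E \<H> U \<subseteq> W"
      by (elim exE conjE)
    have "{q \<in> topspace (membership_cube \<H>). \<forall>H\<in>{H \<in> \<H>. U H \<noteq> UNIV}. q H = p H} \<subseteq> Pi\<^sub>E \<H> U"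
    proof
      fix q assume q: "q \<in> {q \<in> topspace (membership_cube \<H>). \<forall>H\<in>{H \<in> \<H>. U H \<noteq> UNIV}. q H = p H}"
      have "q H \<in> U H" if "H \<in> \<H>" for H
        using q that PiE_mem[OF U(2) that] by (cases "U H = UNIV") auto
      thus "q \<in> Pi\<^sub>E \<H> U"
        using q by (simp add: PiE_iff topspace_membership_cube)
    qed
    thus ?thesis
      using U by (intro exI[of _ "{H \<in> \<H>. U H \<noteq> UNIV}"]) auto
  qed
  thus ?nbhds
    using openin_subset[OF \<open>?open\<close>] by blast
next
  assume nbhds: ?nbhds
  have "\<exists>U. finite {H \<in> \<H>. U H \<noteq> (UNIV :: bool set)} \<and> p \<in> Pi\<^sub>E \<H> U \<and> Pi\<^sub>E \<H> U \<subseteq> W"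
    if "p \<in> W" for p
  proof -
    from bspec[OF conjunct2[OF nbhds] that] obtain S where S: "finite S" "S \<subseteq> \<H>"
      "{q \<in> topspace (membership_cube \<H>). \<forall>H\<in>S. q H = p H} \<subseteq> W"
      by (elim exE conjE)
    define U where "U H = (if H \<in> S then {p H} else UNIV)" for H
    have "finite {H \<in> \<H>. U H \<noteq> UNIV}"
      by (rule finite_subset[OF _ S(1)]) (auto simp: U_def)
    moreover have "p \<in> Pi\<^sub>E \<H> U"
      using nbhds that by (auto simp: PiE_iff U_def topspace_membership_cube)
    moreover have "Pi\<^sub>E \<H> U \<subseteq> {q \<in> topspace (membership_cube \<H>). \<forall>H\<in>S. q H = p H}"
      using S(2) by (force simp: PiE_iff U_def topspace_membership_cube)
    ultimately show ?thesis
      using S(3) by (meson order_trans)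
  qed
  thus ?open
    unfolding membership_cube_def openin_product_topology_alt by auto
qed

text \<open>Stated for an arbitrary map into the cube, because it is applied both to points of \<open>X\<close> and to
  Cauchy filters on \<open>X\<close>.\<close>

lemma openin_pullback_membership_cube:
  assumes f: "f ` A \<subseteq> topspace (membership_cube \<H>)"
  shows "openin (pullback_topology A f (membership_cube \<H>)) W \<longleftrightarrow> W \<subseteq> A \<and>
    (\<forall>x\<in>W. \<exists>S. finite S \<and> S \<subseteq> \<H> \<and> {y \<in> A. \<forall>H\<in>S. f y H = f x H} \<subseteq> W)"
    (is "?open \<longleftrightarrow> ?nbhds")
proof
  assume ?open
  then obtain V where V: "openin (membership_cube \<H>) V" "W = f -` V \<inter> A"
    unfolding openin_pullback_topology by blast
  have "\<exists>S. finite S \<and> S \<subseteq> \<H> \<and> {y \<in> A. \<forall>H\<in>S. f y H = f x H} \<subseteq> W" if "x \<in> W" for x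
  proof -
    obtain S where S: "finite S" "S \<subseteq> \<H>"
      "{q \<in> topspace (membership_cube \<H>). \<forall>H\<in>S. q H = f x H} \<subseteq> V"
      using V \<open>x \<in> W\<close> unfolding openin_membership_cube by blast
    hence "{y \<in> A. \<forall>H\<in>S. f y H = f x H} \<subseteq> W"
      using V(2) f by blast
    thus ?thesis
      using S by blast
  qed
  thus ?nbhds
    using V by blast
next
  assume nbhds: ?nbhds
  define V where "V = {q \<in> topspace (membership_cube \<H>).
    \<exists>x\<in>W. \<exists>S. finite S \<and> S \<subseteq> \<H> \<and> (\<forall>H\<in>S. q H = f x H) \<and> {y \<in> A. \<forall>H\<in>S. f y H = f x H} \<subseteq> W}"
  have "openin (membership_cube \<H>) V"
    unfolding openin_membership_cube
  proof (intro conjI ballI)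
    fix p assume "p \<in> V"
    then obtain x S where S: "x \<in> W" "finite S" "S \<subseteq> \<H>" "\<forall>H\<in>S. p H = f x H"
      "{y \<in> A. \<forall>H\<in>S. f y H = f x H} \<subseteq> W"
      unfolding V_def by blast
    have "{q \<in> topspace (membership_cube \<H>). \<forall>H\<in>S. q H = p H} \<subseteq> V"
    proof
      fix q assume q: "q \<in> {q \<in> topspace (membership_cube \<H>). \<forall>H\<in>S. q H = p H}"
      hence "\<forall>H\<in>S. q H = f x H"
        using S(4) by simp
      with q S show "q \<in> V"
        unfolding V_def by blast
    qed
    thus "\<exists>S. finite S \<and> S \<subseteq> \<H> \<and> {q \<in> topspace (membership_cube \<H>). \<forall>H\<in>S. q H = p H} \<subseteq> V"
      using S by blast
  qed (auto simp: V_def)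
  moreover have "W = f -` V \<inter> A"
  proof (intro set_eqI iffI)
    fix x assume x: "x \<in> W"
    then obtain S where "finite S" "S \<subseteq> \<H>" "{y \<in> A. \<forall>H\<in>S. f y H = f x H} \<subseteq> W"
      using nbhds by blast
    thus "x \<in> f -` V \<inter> A"
      using x nbhds f unfolding V_def by blast
  next
    fix y assume "y \<in> f -` V \<inter> A"
    thus "y \<in> W"
      unfolding V_def by blast
  qed
  ultimately show ?open
    unfolding openin_pullback_topology by blast
qed

lemma in_closure_membership_cube:
  "p \<in> membership_cube \<H> closure_of A \<longleftrightarrow> p \<in> topspace (membership_cube \<H>) \<and>
     (\<forall>S. finite S \<and> S \<subseteq> \<H> \<longrightarrow> (\<exists>q\<in>A \<inter> topspace (membership_cube \<H>). \<forall>H\<in>S. q H = p H))"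
    (is "?closure \<longleftrightarrow> ?approx")
proof
  assume closure: ?closure
  have "\<exists>q\<in>A \<inter> topspace (membership_cube \<H>). \<forall>H\<in>S. q H = p H" if S: "finite S" "S \<subseteq> \<H>" for S
  proof -
    let ?W = "{q \<in> topspace (membership_cube \<H>). \<forall>H\<in>S. q H = p H}"
    have "openin (membership_cube \<H>) ?W"
      unfolding openin_membership_cube
    proof (intro conjI ballI)
      fix p' assume "p' \<in> ?W"
      hence "{q \<in> topspace (membership_cube \<H>). \<forall>H\<in>S. q H = p' H} \<subseteq> ?W" by auto
      thus "\<exists>S'. finite S' \<and> S' \<subseteq> \<H> \<and>
          {q \<in> topspace (membership_cube \<H>). \<forall>H\<in>S'. q H = p' H} \<subseteq> ?W"
        using S by blast
    qed auto
    moreover have "p \<in> ?W"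
      using closure by (simp add: in_closure_of)
    moreover have "\<forall>T. p \<in> T \<and> openin (membership_cube \<H>) T \<longrightarrow> (\<exists>q. q \<in> A \<and> q \<in> T)"
      using closure by (simp add: in_closure_of)
    ultimately have "\<exists>q. q \<in> A \<and> q \<in> ?W"
      by (elim allE[of _ ?W]) simp
    thus ?thesis by auto
  qed
  thus ?approx
    using closure unfolding in_closure_of by simp
next
  assume approx: ?approx
  show ?closure
    unfolding in_closure_of
  proof (intro conjI allI impI)
    fix W assume "p \<in> W \<and> openin (membership_cube \<H>) W"
    then obtain S where "finite S" "S \<subseteq> \<H>"
      "{q \<in> topspace (membership_cube \<H>). \<forall>H\<in>S. q H = p H} \<subseteq> W"
      unfolding openin_membership_cube by blast
    thus "\<exists>y. y \<in> A \<and> y \<in> W"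
      using approx by blast
  qed (use approx in blast)
qed

lemma homeomorphic_map_pullback_image:
  assumes "inj_on f A" "f ` A \<subseteq> topspace T"
  shows "homeomorphic_map (pullback_topology A f T) (subtopology T (f ` A)) f"
proof -
  have top: "topspace (pullback_topology A f T) = A"
    using assms(2) by (auto simp: topspace_pullback_topology)
  have "continuous_map (pullback_topology A f T) T f"
    using continuous_map_pullback[OF continuous_map_id, of A f T] by simp
  moreover have "open_map (pullback_topology A f T) (subtopology T (f ` A)) f"
    unfolding open_map_def openin_pullback_topology openin_subtopology
    by (force simp: image_iff)
  ultimately show ?thesis
    using assms top
    by (intro bijective_open_imp_homeomorphic_map) (auto simp: continuous_map_in_subtopology)
qed

abbreviation two_set_partitions :: "'a set \<Rightarrow> 'a set set \<Rightarrow> 'a set set set" where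
  "two_set_partitions X \<H> \<equiv> (\<lambda>H. {H, X - H}) ` \<H>"

abbreviation partition_uniformity :: "'a set \<Rightarrow> 'a set set \<Rightarrow> 'a set set set" where
  "partition_uniformity X \<H> \<equiv> uniformity_from_subbase X (two_set_partitions X \<H>)"

definition partition_cell :: "'a set \<Rightarrow> 'a set set \<Rightarrow> 'a \<Rightarrow> 'a set" where
  "partition_cell X S x = {y \<in> X. \<forall>H\<in>S. y \<in> H \<longleftrightarrow> x \<in> H}"

text \<open>A choice of one side of each partition may be contradictory, and then the member is empty;
  otherwise it is the choice made by each of its points.\<close>

lemma common_refinement_member:
  assumes "d \<in> common_refinement X (two_set_partitions X S)" "x \<in> d" "S \<subseteq> Pow X"
  shows "d = partition_cell X S x"
proof -
  obtain f where f: "d = X \<inter> (\<Inter>C\<in>two_set_partitions X S. f C)"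
    "\<forall>C\<in>two_set_partitions X S. f C \<in> C"
    using assms(1) unfolding common_refinement_def by blast
  have "x \<in> X"
    using assms(2) f(1) by blast
  have f_eq: "f {H, X - H} = (if x \<in> H then H else X - H)" if "H \<in> S" for H
  proof -
    have "f {H, X - H} \<in> {H, X - H}"
      using that f(2) by simp
    moreover have "x \<in> f {H, X - H}"
      using that f(1) assms(2) by simp
    ultimately show ?thesis by auto
  qed
  have "d = {y \<in> X. \<forall>H\<in>S. y \<in> f {H, X - H}}"
    unfolding f(1) by auto
  also have "\<dots> = partition_cell X S x"
    using f_eq unfolding partition_cell_def by (auto split: if_splits)
  finally show ?thesis .
qed

lemma partition_cell_in_common_refinement:
  assumes "x \<in> X" "S \<subseteq> Pow X"
  shows "partition_cell X S x \<in> common_refinement X (two_set_partitions X S)"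
proof -
  define f where "f C = (SOME c. c \<in> C \<and> x \<in> c)" for C
  have f: "f C \<in> C" "x \<in> f C" if "C \<in> two_set_partitions X S" for C
  proof -
    have "\<exists>c. c \<in> C \<and> x \<in> c"
      using that assms by blast
    thus "f C \<in> C" "x \<in> f C"
      unfolding f_def by (metis (mono_tags, lifting) someI_ex)+
  qed
  have "X \<inter> (\<Inter>C\<in>two_set_partitions X S. f C) \<in> common_refinement X (two_set_partitions X S)"
    unfolding common_refinement_def using f(1) by blast
  moreover have "x \<in> X \<inter> (\<Inter>C\<in>two_set_partitions X S. f C)"
    using f(2) assms(1) by blast
  ultimately show ?thesis
    using common_refinement_member[OF _ _ assms(2)] by simp
qed

lemma partition_uniformity_cells:
  assumes "C \<in> partition_uniformity X \<H>" "\<H> \<subseteq> Pow X"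
  obtains S where "finite S" "S \<subseteq> \<H>" "\<forall>x\<in>X. \<exists>c\<in>C. partition_cell X S x \<subseteq> c"
proof -
  obtain P where P: "finite P" "P \<subseteq> two_set_partitions X \<H>" "refines (common_refinement X P) C"
    using assms(1) unfolding uniformity_from_subbase_def by blast
  then obtain S where S: "finite S" "S \<subseteq> \<H>" "P = two_set_partitions X S"
    using finite_subset_image[OF P(1,2)] by blast
  have "\<exists>c\<in>C. partition_cell X S x \<subseteq> c" if "x \<in> X" for x
    using partition_cell_in_common_refinement[OF that, of S] S assms(2) P(3)
    unfolding refines_def by blast
  thus thesis
    using that S by blast
qed

lemma common_refinement_in_partition_uniformity:
  assumes "finite S" "S \<subseteq> \<H>" "\<H> \<subseteq> Pow X"
  shows "common_refinement X (two_set_partitions X S) \<in> partition_uniformity X \<H>"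
proof -
  have "x \<in> \<Union> (common_refinement X (two_set_partitions X S))" if "x \<in> X" for x
  proof -
    have "x \<in> partition_cell X S x"
      using that by (simp add: partition_cell_def)
    thus ?thesis
      using partition_cell_in_common_refinement[OF that, of S] assms by blast
  qed
  moreover have "common_refinement X (two_set_partitions X S) \<subseteq> Pow X"
    unfolding common_refinement_def by blast
  ultimately have "is_cover X (common_refinement X (two_set_partitions X S))"
    unfolding is_cover_def by blast
  moreover have "finite (two_set_partitions X S)" "two_set_partitions X S \<subseteq> two_set_partitions X \<H>"
    using assms by auto
  ultimately show ?thesis
    unfolding uniformity_from_subbase_def refines_def by blast
qed

lemma partition_uniform_star:
  assumes "\<H> \<subseteq> Pow X" "x \<in> X"
  shows "(\<exists>C\<in>partition_uniformity X \<H>. cover_star C x \<subseteq> W) \<longleftrightarrow>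
    (\<exists>S. finite S \<and> S \<subseteq> \<H> \<and> partition_cell X S x \<subseteq> W)"
proof
  assume "\<exists>C\<in>partition_uniformity X \<H>. cover_star C x \<subseteq> W"
  then obtain C where C: "C \<in> partition_uniformity X \<H>" "cover_star C x \<subseteq> W" by blast
  obtain S where S: "finite S" "S \<subseteq> \<H>" "\<forall>x\<in>X. \<exists>c\<in>C. partition_cell X S x \<subseteq> c"
    using partition_uniformity_cells[OF C(1) assms(1)] .
  obtain c where c: "c \<in> C" "partition_cell X S x \<subseteq> c"
    using S(3) assms(2) by blast
  moreover have "x \<in> partition_cell X S x"
    using assms(2) by (simp add: partition_cell_def)
  ultimately have "partition_cell X S x \<subseteq> cover_star C x"
    unfolding cover_star_def by blast
  thus "\<exists>S. finite S \<and> S \<subseteq> \<H> \<and> partition_cell X S x \<subseteq> W"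
    using S(1,2) C(2) by (meson order_trans)
next
  assume "\<exists>S. finite S \<and> S \<subseteq> \<H> \<and> partition_cell X S x \<subseteq> W"
  then obtain S where S: "finite S" "S \<subseteq> \<H>" "partition_cell X S x \<subseteq> W" by blast
  have "cover_star (common_refinement X (two_set_partitions X S)) x \<subseteq> partition_cell X S x"
    unfolding cover_star_def using common_refinement_member[of _ X S x] S(2) assms(1) by blast
  thus "\<exists>C\<in>partition_uniformity X \<H>. cover_star C x \<subseteq> W"
    using common_refinement_in_partition_uniformity[OF S(1,2) assms(1)] S(3) by blast
qed

text \<open>Stars of \<open>x\<close> in uniform covers and cells of \<open>x\<close> are cofinal in each other, and the cells are the traces of the basic
  neighbourhoods in the cube.\<close>

lemma uniform_topology_partition:
  assumes "\<H> \<subseteq> Pow X"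
  shows "uniform_topology X (partition_uniformity X \<H>) =
    pullback_topology X (membership_map \<H>) (membership_cube \<H>)"
proof -
  let ?T = "pullback_topology X (membership_map \<H>) (membership_cube \<H>)"
  have cell: "{y \<in> X. \<forall>H\<in>S. membership_map \<H> y H = membership_map \<H> x H} = partition_cell X S x"
    if "S \<subseteq> \<H>" for S x
    using that by (auto simp: membership_map_def partition_cell_def)
  have "(\<lambda>W. W \<subseteq> X \<and> (\<forall>x\<in>W. \<exists>C\<in>partition_uniformity X \<H>. cover_star C x \<subseteq> W)) = openin ?T"
  proof
    fix W
    have "openin ?T W \<longleftrightarrow>
        W \<subseteq> X \<and> (\<forall>x\<in>W. \<exists>S. finite S \<and> S \<subseteq> \<H> \<and> partition_cell X S x \<subseteq> W)"
      using membership_map_in_cube cell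
      by (subst openin_pullback_membership_cube) (auto cong: conj_cong)
    also have "\<dots> \<longleftrightarrow> W \<subseteq> X \<and> (\<forall>x\<in>W. \<exists>C\<in>partition_uniformity X \<H>. cover_star C x \<subseteq> W)"
      using partition_uniform_star[OF assms] by blast
    finally show "(W \<subseteq> X \<and> (\<forall>x\<in>W. \<exists>C\<in>partition_uniformity X \<H>. cover_star C x \<subseteq> W)) = openin ?T W"
      by simp
  qed
  thus ?thesis
    unfolding uniform_topology_def by (simp add: openin_inverse)
qed

text \<open>A proper filter that decides each of finitely many sets contains the set of all points with the
  same decisions; this set is nonempty, hence a cell.\<close>

lemma cauchy_partition:
  assumes "\<H> \<subseteq> Pow X"
  shows "cauchy_on X (partition_uniformity X \<H>) F \<longleftrightarrow>
    F \<noteq> bot \<and> eventually (\<lambda>x. x \<in> X) F \<and>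
    (\<forall>H\<in>\<H>. eventually (\<lambda>x. x \<in> H) F \<or> eventually (\<lambda>x. x \<in> X - H) F)"
    (is "?cauchy \<longleftrightarrow> ?decides")
proof
  assume cauchy: ?cauchy
  have "{H, X - H} \<in> partition_uniformity X \<H>" if "H \<in> \<H>" for H
  proof -
    have "is_cover X {H, X - H}" "refines (common_refinement X {{H, X - H}}) {H, X - H}"
      using that assms unfolding is_cover_def refines_def common_refinement_def by auto
    thus ?thesis
      unfolding uniformity_from_subbase_def using that by blast
  qed
  hence "\<exists>c\<in>{H, X - H}. eventually (\<lambda>x. x \<in> c) F" if "H \<in> \<H>" for H
    using cauchy that unfolding cauchy_on_def by blast
  thus ?decides
    using cauchy unfolding cauchy_on_def by simp
next
  assume decides: ?decides
  have "\<exists>c\<in>C. eventually (\<lambda>x. x \<in> c) F" if C: "C \<in> partition_uniformity X \<H>" for C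
  proof -
    obtain S where S: "finite S" "S \<subseteq> \<H>" "\<forall>x\<in>X. \<exists>c\<in>C. partition_cell X S x \<subseteq> c"
      using partition_uniformity_cells[OF C assms] .
    have "eventually (\<lambda>x. x \<in> H \<longleftrightarrow> eventually (\<lambda>x. x \<in> H) F) F" if "H \<in> S" for H
    proof (cases "eventually (\<lambda>x. x \<in> H) F")
      case False
      hence "eventually (\<lambda>x. x \<in> X - H) F"
        using decides that S(2) by blast
      thus ?thesis
        by (rule eventually_mono) (simp add: False)
    qed simp
    hence "eventually (\<lambda>x. x \<in> X \<and> (\<forall>H\<in>S. x \<in> H \<longleftrightarrow> eventually (\<lambda>x. x \<in> H) F)) F"
      using decides S(1) by (simp add: eventually_conj_iff eventually_ball_finite_distrib)
    moreover from this obtain x where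
      x: "x \<in> X" "\<forall>H\<in>S. x \<in> H \<longleftrightarrow> eventually (\<lambda>x. x \<in> H) F"
      using decides eventually_happens'[of F] by blast
    ultimately have "eventually (\<lambda>y. y \<in> partition_cell X S x) F"
      by (auto simp: partition_cell_def elim: eventually_mono)
    moreover obtain c where c: "c \<in> C" "partition_cell X S x \<subseteq> c"
      using S(3) x(1) by blast
    ultimately have "eventually (\<lambda>y. y \<in> c) F"
      by (auto elim: eventually_mono)
    thus ?thesis
      using c(1) by blast
  qed
  thus ?cauchy
    using decides unfolding cauchy_on_def by blast
qed

text \<open>The extension of \<^const>\<open>membership_map\<close> to Cauchy filters, which are exactly the proper
  filters on \<open>X\<close> that decide every \<open>H\<close>.\<close>

definition filter_membership :: "'a set set \<Rightarrow> 'a filter \<Rightarrow> 'a set \<Rightarrow> bool" where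
  "filter_membership \<H> F = (\<lambda>H\<in>\<H>. eventually (\<lambda>x. x \<in> H) F)"

lemma cauchy_partition_not_mem:
  assumes "\<H> \<subseteq> Pow X" "cauchy_on X (partition_uniformity X \<H>) F" "H \<in> \<H>"
  shows "eventually (\<lambda>x. x \<in> X - H) F \<longleftrightarrow> \<not> eventually (\<lambda>x. x \<in> H) F"
proof -
  have "F \<noteq> bot" "eventually (\<lambda>x. x \<in> H) F \<or> eventually (\<lambda>x. x \<in> X - H) F"
    using assms unfolding cauchy_partition[OF assms(1)] by auto
  moreover have "\<not> (eventually (\<lambda>x. x \<in> H) F \<and> eventually (\<lambda>x. x \<in> X - H) F)"
  proof
    assume "eventually (\<lambda>x. x \<in> H) F \<and> eventually (\<lambda>x. x \<in> X - H) F"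
    hence "eventually (\<lambda>x. x \<in> H \<and> x \<in> X - H) F"
      by (simp only: eventually_conj_iff)
    hence "eventually (\<lambda>x. False) F"
      by (rule eventually_mono) auto
    thus False
      using \<open>F \<noteq> bot\<close> by simp
  qed
  ultimately show ?thesis by blast
qed

lemma filter_membership_in_cube: "filter_membership \<H> F \<in> topspace (membership_cube \<H>)"
  by (simp add: filter_membership_def topspace_membership_cube)

lemma cauchy_partition_eventually_cell:
  assumes \<H>: "\<H> \<subseteq> Pow X" and F: "cauchy_on X (partition_uniformity X \<H>) F"
    and S: "finite S" "S \<subseteq> \<H>"
  shows "eventually (\<lambda>y. y \<in> partition_cell X S x) F \<longleftrightarrow>
    (\<forall>H\<in>S. filter_membership \<H> F H \<longleftrightarrow> x \<in> H)"
proof -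
  have X: "eventually (\<lambda>y. y \<in> X) F"
    using F unfolding cauchy_on_def by blast
  have "eventually (\<lambda>y. y \<in> H \<longleftrightarrow> x \<in> H) F \<longleftrightarrow> (filter_membership \<H> F H \<longleftrightarrow> x \<in> H)" if "H \<in> S" for H
  proof -
    have H: "H \<in> \<H>"
      using that S by blast
    have "eventually (\<lambda>y. y \<notin> H) F \<longleftrightarrow> eventually (\<lambda>y. y \<in> X - H) F"
      using X by (auto simp: eventually_conj_iff)
    thus ?thesis
      using cauchy_partition_not_mem[OF \<H> F H] H
      by (cases "x \<in> H") (simp_all add: filter_membership_def)
  qed
  moreover have "eventually (\<lambda>y. y \<in> partition_cell X S x) F \<longleftrightarrow>
      (\<forall>H\<in>S. eventually (\<lambda>y. y \<in> H \<longleftrightarrow> x \<in> H) F)"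
    using X S(1)
    by (simp add: partition_cell_def eventually_conj_iff eventually_ball_finite_distrib)
  ultimately show ?thesis by blast
qed

lemma cauchy_partition_obtain_cell:
  assumes \<H>: "\<H> \<subseteq> Pow X" and F: "cauchy_on X (partition_uniformity X \<H>) F"
    and S: "finite S" "S \<subseteq> \<H>"
  obtains x where "x \<in> X" "\<forall>H\<in>S. filter_membership \<H> F H \<longleftrightarrow> x \<in> H"
proof -
  let ?C = "common_refinement X (two_set_partitions X S)"
  have "F \<noteq> bot"
    using F unfolding cauchy_on_def by blast
  obtain c where c: "c \<in> ?C" "eventually (\<lambda>y. y \<in> c) F"
    using F common_refinement_in_partition_uniformity[OF S \<H>] unfolding cauchy_on_def by blast
  then obtain x where "x \<in> c"
    using eventually_happens'[OF \<open>F \<noteq> bot\<close>] by blast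
  hence "x \<in> X" "c = partition_cell X S x"
    using c(1) common_refinement_member[OF c(1)] S(2) \<H> by (auto simp: common_refinement_def)
  thus thesis
    using that[of x] cauchy_partition_eventually_cell[OF \<H> F S] c(2) by blast
qed

text \<open>Two Cauchy filters that decide all \<open>H\<close> in the same way have a common coarsening that is still
  Cauchy, so a minimal Cauchy filter is determined by its decisions.\<close>

lemma inj_on_filter_membership:
  assumes \<H>: "\<H> \<subseteq> Pow X"
  shows "inj_on (filter_membership \<H>) (completion_points X (partition_uniformity X \<H>))"
proof (rule inj_onI)
  fix F G
  assume F: "F \<in> completion_points X (partition_uniformity X \<H>)"
    and G: "G \<in> completion_points X (partition_uniformity X \<H>)"
    and eq: "filter_membership \<H> F = filter_membership \<H> G"
  have FG: "cauchy_on X (partition_uniformity X \<H>) F" "cauchy_on X (partition_uniformity X \<H>) G"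
    using F G unfolding completion_points_def by auto
  \<comment> \<open>In the library order, \<open>sup F G\<close> is the intersection of the two filters as families of sets.\<close>
  have "eventually (\<lambda>x. x \<in> H) (sup F G) \<or> eventually (\<lambda>x. x \<in> X - H) (sup F G)" if "H \<in> \<H>" for H
    using fun_cong[OF eq, of H] that
      cauchy_partition_not_mem[OF \<H> FG(1) that] cauchy_partition_not_mem[OF \<H> FG(2) that]
    by (auto simp: filter_membership_def eventually_sup)
  moreover have "F \<noteq> bot" "eventually (\<lambda>x. x \<in> X) F" "eventually (\<lambda>x. x \<in> X) G"
    using FG unfolding cauchy_on_def by auto
  ultimately have "cauchy_on X (partition_uniformity X \<H>) (sup F G)"
    unfolding cauchy_partition[OF \<H>] by (auto simp: eventually_sup)
  hence "sup F G = F" "sup F G = G"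
    using F G unfolding completion_points_def by auto
  thus "F = G" by simp
qed

text \<open>Conversely, a point \<open>p\<close> of the closure prescribes decisions of which any finitely many are
  realised in \<open>X\<close>; the filter that they generate is Cauchy, and it is minimal because each of its
  generators is forced.\<close>

lemma filter_membership_image:
  assumes \<H>: "\<H> \<subseteq> Pow X"
  shows "filter_membership \<H> ` completion_points X (partition_uniformity X \<H>) =
    membership_cube \<H> closure_of (membership_map \<H> ` X)"
    (is "_ ` ?P = ?K")
proof (intro equalityI subsetI)
  fix p assume "p \<in> filter_membership \<H> ` ?P"
  then obtain F where F: "cauchy_on X (partition_uniformity X \<H>) F" "p = filter_membership \<H> F"
    unfolding completion_points_def by blast
  show "p \<in> ?K"
    unfolding in_closure_membership_cube
  proof (intro conjI allI impI)
    fix S assume S: "finite S \<and> S \<subseteq> \<H>"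
    then obtain x where x: "x \<in> X" "\<forall>H\<in>S. filter_membership \<H> F H \<longleftrightarrow> x \<in> H"
      using cauchy_partition_obtain_cell[OF \<H> F(1), of S] by blast
    hence "\<forall>H\<in>S. membership_map \<H> x H = p H"
      using S F(2) by (auto simp: membership_map_def)
    thus "\<exists>q\<in>membership_map \<H> ` X \<inter> topspace (membership_cube \<H>). \<forall>H\<in>S. q H = p H"
      using membership_map_in_cube x(1) by (intro bexI[of _ "membership_map \<H> x"]) auto
  qed (simp add: F(2) filter_membership_in_cube)
next
  fix p assume p: "p \<in> ?K"
  \<comment> \<open>\<open>X\<close> has to be a generator of its own in case \<open>\<H>\<close> is empty.\<close>
  define gens where "gens = insert X ((\<lambda>H. {x \<in> X. x \<in> H \<longleftrightarrow> p H}) ` \<H>)"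
  define F where "F = (INF c\<in>gens. principal c)"
  have "F \<noteq> bot"
  proof
    assume "F = bot"
    then obtain D where D: "D \<subseteq> gens" "finite D" "(INF c\<in>D. principal c) = bot"
      unfolding F_def using INF_filter_bot_base
      by (metis INF_filter_not_bot)
    have "finite (D - {X})" "D - {X} \<subseteq> (\<lambda>H. {x \<in> X. x \<in> H \<longleftrightarrow> p H}) ` \<H>"
      using D by (auto simp: gens_def)
    then obtain S where S: "finite S" "S \<subseteq> \<H>" "D - {X} = (\<lambda>H. {x \<in> X. x \<in> H \<longleftrightarrow> p H}) ` S"
      by (meson finite_subset_image)
    then obtain q where "q \<in> membership_map \<H> ` X" "\<forall>H\<in>S. q H = p H"
      using p unfolding in_closure_membership_cube by blast
    then obtain x where "x \<in> X" "\<forall>H\<in>S. membership_map \<H> x H = p H"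
      by blast
    moreover from this have "\<forall>H\<in>S. x \<in> H \<longleftrightarrow> p H"
      using S(2) by (simp add: membership_map_def subset_iff)
    ultimately have x: "x \<in> X" "\<forall>H\<in>S. x \<in> H \<longleftrightarrow> p H" by blast+
    have "x \<in> c" if "c \<in> D" for c
    proof (cases "c = X")
      case False
      then obtain H where "H \<in> S" "c = {x \<in> X. x \<in> H \<longleftrightarrow> p H}"
        using S(3) \<open>c \<in> D\<close> by blast
      thus ?thesis
        using x by simp
    qed (simp add: x)
    hence "x \<in> \<Inter>D" by blast
    moreover have "(INF c\<in>D. principal c) = principal (\<Inter>D)"
      using INF_principal_finite[OF D(2), of "\<lambda>c. c"] by simp
    ultimately have "principal (\<Inter>D) = bot" "x \<in> \<Inter>D"
      using D(3) by simp_all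
    thus False
      by (metis empty_iff principal_eq_bot_iff)
  qed
  have gens: "eventually (\<lambda>x. x \<in> c) F" if "c \<in> gens" for c
    using that unfolding F_def by (metis INF_lower eventually_principal filter_leD)
  have decides: "eventually (\<lambda>x. x \<in> X \<and> (x \<in> H \<longleftrightarrow> p H)) F" if "H \<in> \<H>" for H
    using gens[of "{x \<in> X. x \<in> H \<longleftrightarrow> p H}"] that by (simp add: gens_def)
  have F: "cauchy_on X (partition_uniformity X \<H>) F"
    unfolding cauchy_partition[OF \<H>]
  proof (intro conjI ballI)
    fix H assume "H \<in> \<H>"
    thus "eventually (\<lambda>x. x \<in> H) F \<or> eventually (\<lambda>x. x \<in> X - H) F"
      using decides[of H] by (cases "p H") (auto elim: eventually_mono)
  qed (use \<open>F \<noteq> bot\<close> gens in \<open>auto simp: gens_def\<close>)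
  have p_F: "eventually (\<lambda>x. x \<in> H) F \<longleftrightarrow> p H" if "H \<in> \<H>" for H
    using decides[OF that] cauchy_partition_not_mem[OF \<H> F that]
    by (cases "p H") (auto elim: eventually_mono)
  have "G = F" if G: "cauchy_on X (partition_uniformity X \<H>) G" "F \<le> G" for G
  proof (rule antisym)
    have "eventually (\<lambda>x. x \<in> X) G"
      using G unfolding cauchy_on_def by blast
    moreover have "eventually (\<lambda>x. x \<in> X \<and> (x \<in> H \<longleftrightarrow> p H)) G" if "H \<in> \<H>" for H
    proof -
      have "eventually (\<lambda>x. x \<in> H) G \<longleftrightarrow> p H"
        using p_F[OF that] filter_leD[OF G(2)] cauchy_partition_not_mem[OF \<H> F that]
          cauchy_partition_not_mem[OF \<H> G(1) that] by blast
      thus ?thesis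
        using cauchy_partition_not_mem[OF \<H> G(1) that] \<open>eventually (\<lambda>x. x \<in> X) G\<close>
        by (cases "p H") (auto simp: eventually_conj_iff)
    qed
    ultimately show "G \<le> F"
      unfolding F_def by (intro INF_greatest) (auto simp: gens_def le_principal)
  qed (rule G)
  hence "F \<in> ?P"
    using F unfolding completion_points_def by blast
  moreover have "filter_membership \<H> F = p"
  proof
    fix H
    have "p \<in> extensional \<H>"
      using p by (simp add: in_closure_membership_cube topspace_membership_cube)
    thus "filter_membership \<H> F H = p H"
      using p_F[of H] extensional_arb[of p \<H> H]
      by (cases "H \<in> \<H>") (simp_all add: filter_membership_def)
  qed
  ultimately show "p \<in> filter_membership \<H> ` ?P" by blast
qed

lemma completion_space_partition:
  assumes \<H>: "\<H> \<subseteq> Pow X"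
  shows "completion_space X (partition_uniformity X \<H>) =
    pullback_topology (completion_points X (partition_uniformity X \<H>))
      (filter_membership \<H>) (membership_cube \<H>)"
proof -
  let ?U = "partition_uniformity X \<H>"
  let ?P = "completion_points X ?U"
  let ?T = "pullback_topology ?P (filter_membership \<H>) (membership_cube \<H>)"
  let ?lift = "\<lambda>C. (\<lambda>c. {F \<in> ?P. eventually (\<lambda>x. x \<in> c) F}) ` C"
  have cauchy: "cauchy_on X ?U F" if "F \<in> ?P" for F
    using that unfolding completion_points_def by blast
  have star: "(\<exists>D\<in>completion_uniformity X ?U. cover_star D F \<subseteq> W) \<longleftrightarrow>
      (\<exists>S. finite S \<and> S \<subseteq> \<H> \<and>
        {G \<in> ?P. \<forall>H\<in>S. filter_membership \<H> G H = filter_membership \<H> F H} \<subseteq> W)"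
    if F: "F \<in> ?P" for F W
  proof
    assume "\<exists>D\<in>completion_uniformity X ?U. cover_star D F \<subseteq> W"
    then obtain D C where D: "cover_star D F \<subseteq> W" "C \<in> ?U" "refines (?lift C) D"
      unfolding completion_uniformity_def by blast
    obtain S where S: "finite S" "S \<subseteq> \<H>" "\<forall>x\<in>X. \<exists>c\<in>C. partition_cell X S x \<subseteq> c"
      using partition_uniformity_cells[OF D(2) \<H>] .
    obtain x where x: "x \<in> X" "\<forall>H\<in>S. filter_membership \<H> F H \<longleftrightarrow> x \<in> H"
      using cauchy_partition_obtain_cell[OF \<H> cauchy[OF F] S(1,2)] .
    obtain c where c: "c \<in> C" "partition_cell X S x \<subseteq> c"
      using S(3) x(1) by blast
    obtain d where d: "d \<in> D" "{F \<in> ?P. eventually (\<lambda>x. x \<in> c) F} \<subseteq> d"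
      using D(3) c(1) unfolding refines_def by blast
    have in_d: "G \<in> d" if "G \<in> ?P" "\<forall>H\<in>S. filter_membership \<H> G H = filter_membership \<H> F H" for G
    proof -
      have "eventually (\<lambda>y. y \<in> partition_cell X S x) G"
        using cauchy_partition_eventually_cell[OF \<H> cauchy[OF that(1)] S(1,2)] that(2) x(2) by simp
      thus ?thesis
        using c(2) d(2) that(1) eventually_mono[of "\<lambda>y. y \<in> partition_cell X S x" G "\<lambda>y. y \<in> c"]
        by blast
    qed
    hence "{G \<in> ?P. \<forall>H\<in>S. filter_membership \<H> G H = filter_membership \<H> F H} \<subseteq> cover_star D F"
      using F d(1) unfolding cover_star_def by blast
    thus "\<exists>S. finite S \<and> S \<subseteq> \<H> \<and>
        {G \<in> ?P. \<forall>H\<in>S. filter_membership \<H> G H = filter_membership \<H> F H} \<subseteq> W"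
      using S(1,2) D(1) by (meson order_trans)
  next
    assume "\<exists>S. finite S \<and> S \<subseteq> \<H> \<and>
        {G \<in> ?P. \<forall>H\<in>S. filter_membership \<H> G H = filter_membership \<H> F H} \<subseteq> W"
    then obtain S where S: "finite S" "S \<subseteq> \<H>"
      "{G \<in> ?P. \<forall>H\<in>S. filter_membership \<H> G H = filter_membership \<H> F H} \<subseteq> W" by blast
    define C where "C = common_refinement X (two_set_partitions X S)"
    have C: "C \<in> ?U"
      unfolding C_def by (rule common_refinement_in_partition_uniformity[OF S(1,2) \<H>])
    have "is_cover ?P (?lift C)"
      using cauchy C unfolding is_cover_def cauchy_on_def by blast
    hence "?lift C \<in> completion_uniformity X ?U"
      using C unfolding completion_uniformity_def refines_def by blast
    moreover have "cover_star (?lift C) F \<subseteq> W"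
    proof
      fix G assume "G \<in> cover_star (?lift C) F"
      then obtain c where c: "c \<in> C" "eventually (\<lambda>x. x \<in> c) F" "eventually (\<lambda>x. x \<in> c) G"
        and G: "G \<in> ?P"
        unfolding cover_star_def by blast
      have "F \<noteq> bot"
        using cauchy[OF F] unfolding cauchy_on_def by blast
      then obtain x where "x \<in> c"
        using c(2) eventually_happens' by blast
      hence "c = partition_cell X S x"
        using c(1) common_refinement_member[of c X S x] S(2) \<H> unfolding C_def by blast
      hence "filter_membership \<H> G H = filter_membership \<H> F H" if "H \<in> S" for H
        using c(2,3) that cauchy_partition_eventually_cell[OF \<H> cauchy[OF F] S(1,2)]
          cauchy_partition_eventually_cell[OF \<H> cauchy[OF G] S(1,2)] by blast
      thus "G \<in> W"
        using S(3) G by blast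
    qed
    ultimately show "\<exists>D\<in>completion_uniformity X ?U. cover_star D F \<subseteq> W" by blast
  qed
  have "(\<lambda>W. W \<subseteq> ?P \<and> (\<forall>F\<in>W. \<exists>D\<in>completion_uniformity X ?U. cover_star D F \<subseteq> W)) = openin ?T"
  proof
    fix W
    have "openin ?T W \<longleftrightarrow> W \<subseteq> ?P \<and> (\<forall>F\<in>W. \<exists>S. finite S \<and> S \<subseteq> \<H> \<and>
        {G \<in> ?P. \<forall>H\<in>S. filter_membership \<H> G H = filter_membership \<H> F H} \<subseteq> W)"
      using filter_membership_in_cube by (subst openin_pullback_membership_cube) auto
    also have "\<dots> \<longleftrightarrow> W \<subseteq> ?P \<and> (\<forall>F\<in>W. \<exists>D\<in>completion_uniformity X ?U. cover_star D F \<subseteq> W)"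
      by (intro conj_cong ball_cong refl star[symmetric]) blast
    finally show "(W \<subseteq> ?P \<and> (\<forall>F\<in>W. \<exists>D\<in>completion_uniformity X ?U. cover_star D F \<subseteq> W)) =
        openin ?T W" by simp
  qed
  thus ?thesis
    unfolding completion_space_def uniform_topology_def by (simp add: openin_inverse)
qed

theorem completion_space_partition_homeomorphic:
  assumes \<H>: "\<H> \<subseteq> Pow X"
  shows "homeomorphic_map (completion_space X (partition_uniformity X \<H>))
    (subtopology (membership_cube \<H>) (membership_cube \<H> closure_of (membership_map \<H> ` X)))
    (filter_membership \<H>)"
  unfolding completion_space_partition[OF \<H>] filter_membership_image[OF \<H>, symmetric]
  by (rule homeomorphic_map_pullback_image[OF inj_on_filter_membership[OF \<H>]])
    (use filter_membership_in_cube in auto)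

text \<open>Each side of each partition is open, so the neighbourhood filter of \<open>x\<close> decides every \<open>H\<close> as \<open>x\<close>
  does; any Cauchy filter that it refines must make the same decisions and so contains every
  cell of \<open>x\<close>.\<close>

lemma completion_map_partition:
  assumes \<H>: "\<H> \<subseteq> Pow X" and x: "x \<in> X"
  shows "completion_map X (partition_uniformity X \<H>) x \<in>
      completion_points X (partition_uniformity X \<H>)"
    and "filter_membership \<H> (completion_map X (partition_uniformity X \<H>) x) = membership_map \<H> x"
proof -
  let ?U = "partition_uniformity X \<H>"
  let ?T = "uniform_topology X ?U"
  let ?F = "completion_map X ?U x"
  have open_iff: "openin ?T W \<longleftrightarrow> W \<subseteq> X \<and>
      (\<forall>x\<in>W. \<exists>S. finite S \<and> S \<subseteq> \<H> \<and>
        {y \<in> X. \<forall>H\<in>S. membership_map \<H> y H = membership_map \<H> x H} \<subseteq> W)" for W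
    unfolding uniform_topology_partition[OF \<H>]
    using membership_map_in_cube by (subst openin_pullback_membership_cube) auto
  have top: "topspace ?T = X"
    unfolding uniform_topology_partition[OF \<H>] topspace_pullback_topology
    using membership_map_in_cube by auto
  have ev: "eventually P ?F \<longleftrightarrow> (\<exists>W. openin ?T W \<and> x \<in> W \<and> (\<forall>y\<in>W. P y))" for P
    unfolding completion_map_def eventually_nhdsin top using x by blast
  have half_open: "openin ?T {y \<in> X. y \<in> H \<longleftrightarrow> x \<in> H}" if "H \<in> \<H>" for H
    unfolding open_iff
  proof (intro conjI ballI)
    fix z assume "z \<in> {y \<in> X. y \<in> H \<longleftrightarrow> x \<in> H}"
    thus "\<exists>S. finite S \<and> S \<subseteq> \<H> \<and> {y \<in> X. \<forall>H\<in>S. membership_map \<H> y H = membership_map \<H> z H}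
        \<subseteq> {y \<in> X. y \<in> H \<longleftrightarrow> x \<in> H}"
      using that by (intro exI[of _ "{H}"]) (auto simp: membership_map_def)
  qed auto
  have decides: "eventually (\<lambda>y. y \<in> X \<and> (y \<in> H \<longleftrightarrow> x \<in> H)) ?F" if "H \<in> \<H>" for H
    unfolding ev using half_open[OF that] x by blast
  have "openin ?T X"
    using openin_topspace[of ?T] top by simp
  hence ev_X: "eventually (\<lambda>y. y \<in> X) ?F"
    unfolding ev using x by blast
  have "?F \<noteq> bot"
    using ev[of "\<lambda>_. False"] by (auto simp: trivial_limit_def)
  moreover have "eventually (\<lambda>y. y \<in> H) ?F \<or> eventually (\<lambda>y. y \<in> X - H) ?F" if "H \<in> \<H>" for H
    using decides[OF that] by (cases "x \<in> H") (auto elim: eventually_mono)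
  ultimately have F: "cauchy_on X ?U ?F"
    unfolding cauchy_partition[OF \<H>] using ev_X by blast
  have F_iff: "eventually (\<lambda>y. y \<in> H) ?F \<longleftrightarrow> x \<in> H" if "H \<in> \<H>" for H
    using decides[OF that] cauchy_partition_not_mem[OF \<H> F that]
    by (cases "x \<in> H") (auto elim: eventually_mono)
  show "filter_membership \<H> ?F = membership_map \<H> x"
    using F_iff unfolding filter_membership_def membership_map_def by (intro restrict_ext) simp
  have "G = ?F" if G: "cauchy_on X ?U G" "?F \<le> G" for G
  proof (rule antisym)
    have G_iff: "filter_membership \<H> G H \<longleftrightarrow> x \<in> H" if "H \<in> \<H>" for H
    proof -
      have "eventually (\<lambda>y. y \<in> H) G \<longleftrightarrow> x \<in> H"
        using F_iff[OF that] filter_leD[OF G(2)] cauchy_partition_not_mem[OF \<H> F that]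
          cauchy_partition_not_mem[OF \<H> G(1) that] by blast
      thus ?thesis
        using that by (simp add: filter_membership_def)
    qed
    show "G \<le> ?F"
    proof (rule filter_leI)
      fix P assume "eventually P ?F"
      then obtain W where W: "openin ?T W" "x \<in> W" "\<forall>y\<in>W. P y"
        unfolding ev by blast
      then obtain S where S: "finite S" "S \<subseteq> \<H>"
        "{y \<in> X. \<forall>H\<in>S. membership_map \<H> y H = membership_map \<H> x H} \<subseteq> W"
        unfolding open_iff by blast
      have "partition_cell X S x \<subseteq> W"
      proof
        fix y assume "y \<in> partition_cell X S x"
        hence "y \<in> X" "\<forall>H\<in>S. membership_map \<H> y H = membership_map \<H> x H"
          using S(2) by (auto simp: partition_cell_def membership_map_def)
        thus "y \<in> W"
          using S(3) by blast
      qed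
      moreover have "eventually (\<lambda>y. y \<in> partition_cell X S x) G"
        using cauchy_partition_eventually_cell[OF \<H> G(1) S(1,2)] G_iff S(2) by blast
      ultimately show "eventually P G"
        using W(3) eventually_mono[of "\<lambda>y. y \<in> partition_cell X S x" G P] by blast
    qed
  qed (rule G)
  thus "?F \<in> completion_points X ?U"
    using F unfolding completion_points_def by blast
qed

section \<open>Median compactifications\<close>

lemma continuous_map_ternary:
  assumes "continuous_ternary K n" "continuous_map Z K f" "continuous_map Z K g" "continuous_map Z K h"
  shows "continuous_map Z K (\<lambda>z. n (f z) (g z) (h z))"
proof -
  have "continuous_map Z (prod_topology K (prod_topology K K)) (\<lambda>z. (f z, g z, h z))"
    using assms by (simp add: continuous_map_pairwise o_def)
  thus ?thesis
    using continuous_map_compose assms(1) unfolding continuous_ternary_def by (fastforce simp: o_def)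
qed

lemma continuous_map_median_of:
  assumes "continuous_ternary K n" "a \<in> topspace K" "b \<in> topspace K"
  shows "continuous_map K K (n a b)"
proof -
  have "continuous_map K K (\<lambda>z. n ((\<lambda>_. a) z) ((\<lambda>_. b) z) (id z))"
    by (rule continuous_map_ternary[OF assms(1)]) (use assms in simp_all)
  thus ?thesis by simp
qed

lemma homeomorphic_map_dense_image:
  assumes "homeomorphic_map K L f" "K closure_of D = topspace K" "D \<subseteq> topspace K"
  shows "L closure_of (f ` D) = topspace L"
  using homeomorphic_map_closure_of[OF assms(1,3)] homeomorphic_imp_surjective_map[OF assms(1)]
    assms(2) by simp

lemma continuous_map_triple_projections:
  "continuous_map (prod_topology K (prod_topology K K)) K fst"
  "continuous_map (prod_topology K (prod_topology K K)) K (\<lambda>z. fst (snd z))"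
  "continuous_map (prod_topology K (prod_topology K K)) K (\<lambda>z. snd (snd z))"
  using continuous_map_compose[OF continuous_map_snd continuous_map_fst, of K K K]
    continuous_map_compose[OF continuous_map_snd continuous_map_snd, of K K K]
  by (auto simp: continuous_map_fst o_def)

text \<open>Both sides of the equation are continuous on \<open>K \<times> K \<times> K\<close>, where \<open>D \<times> D \<times> D\<close> is dense.\<close>

lemma median_preserving_from_dense:
  assumes K: "continuous_ternary K n" and L: "continuous_ternary L p" and "Hausdorff_space L"
    and f: "continuous_map K L f"
    and dense: "K closure_of D = topspace K"
    and eq: "\<And>a b c. \<lbrakk>a \<in> D; b \<in> D; c \<in> D\<rbrakk> \<Longrightarrow> f (n a b c) = p (f a) (f b) (f c)"
  shows "median_preserving (topspace K) n p f"
proof -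
  let ?K3 = "prod_topology K (prod_topology K K)"
  note proj = continuous_map_triple_projections[of K]
  have lhs: "continuous_map ?K3 L (\<lambda>z. f (n (fst z) (fst (snd z)) (snd (snd z))))"
    using continuous_map_compose[OF continuous_map_ternary[OF K proj] f] by (simp add: o_def)
  have proj_f: "continuous_map ?K3 L (\<lambda>z. f (g z))" if "continuous_map ?K3 K g" for g
    using continuous_map_compose[OF that f] by (simp add: o_def)
  have rhs: "continuous_map ?K3 L (\<lambda>z. p (f (fst z)) (f (fst (snd z))) (f (snd (snd z))))"
    using continuous_map_ternary[OF L proj_f[OF proj(1)] proj_f[OF proj(2)] proj_f[OF proj(3)]] .
  have closure: "?K3 closure_of (D \<times> D \<times> D) = topspace ?K3"
    by (simp add: closure_of_Times dense)
  show ?thesis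
    unfolding median_preserving_def
  proof (intro ballI)
    fix a b c assume "a \<in> topspace K" "b \<in> topspace K" "c \<in> topspace K"
    hence "(a, b, c) \<in> ?K3 closure_of (D \<times> D \<times> D)"
      by (simp add: closure)
    from forall_in_closure_of_eq[OF this assms(3) lhs rhs] show "f (n a b c) = p (f a) (f b) (f c)"
      using eq by auto
  qed
qed

lemma median_algebra_transfer:
  assumes p: "median_algebra Y p" and f: "inj_on f X" "f ` X \<subseteq> Y"
    and closed: "\<And>a b c. \<lbrakk>a \<in> X; b \<in> X; c \<in> X\<rbrakk> \<Longrightarrow> n a b c \<in> X"
    and hom: "median_preserving X n p f"
  shows "median_algebra X n"
proof -
  have hom': "f (n a b c) = p (f a) (f b) (f c)" if "a \<in> X" "b \<in> X" "c \<in> X" for a b c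
    using hom that unfolding median_preserving_def by blast
  have f_Y: "f a \<in> Y" if "a \<in> X" for a
    using f that by blast
  have inj: "a = b" if "f a = f b" "a \<in> X" "b \<in> X" for a b
    using f(1) that by (meson inj_onD)
  have p_rules: "p a b c = p b a c" "p a b c = p a c b" "p a b b = b"
    "p (p a x b) x c = p a x (p b x c)"
    if "a \<in> Y" "b \<in> Y" "c \<in> Y" "x \<in> Y" for a b c x
    using p that unfolding median_algebra_def by blast+
  show ?thesis
    unfolding median_algebra_def
  proof (intro conjI ballI)
    fix a b c x assume X: "a \<in> X" "b \<in> X" "c \<in> X" "x \<in> X"
    note Y = f_Y[OF X(1)] f_Y[OF X(2)] f_Y[OF X(3)] f_Y[OF X(4)]
    have n: "n a b c \<in> X" "n b a c \<in> X" "n a c b \<in> X" "n a b b \<in> X" "n a x b \<in> X" "n b x c \<in> X"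
      using X closed by auto
    show "n a b c \<in> X" by (rule n)
    show "n a b c = n b a c" "n a b c = n a c b" "n a b b = b"
      by (rule inj; use X n p_rules(1-3)[OF Y] in \<open>simp add: hom'\<close>)+
    show "n (n a x b) x c = n a x (n b x c)"
      by (rule inj) (use X n closed[OF n(5) X(4,3)] closed[OF X(1,4) n(6)] p_rules(4)[OF Y] in
        \<open>simp_all add: hom'\<close>)
  qed
qed

lemma isomorphic_compactifications_sym:
  assumes "isomorphic_compactifications T m K n \<eta> L p \<theta>"
  shows "isomorphic_compactifications T m L p \<theta> K n \<eta>"
proof -
  obtain f where f: "homeomorphic_map K L f" "median_preserving (topspace K) n p f"
    "\<And>x. x \<in> topspace T \<Longrightarrow> f (\<eta> x) = \<theta> x"
    and K: "median_compactification T m K n \<eta>" and L: "median_compactification T m L p \<theta>"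
    using assms unfolding isomorphic_compactifications_def by blast
  obtain g where g: "homeomorphic_maps K L f g"
    using f(1) by (meson homeomorphic_map_maps)
  have g_inv: "\<And>x. x \<in> topspace K \<Longrightarrow> g (f x) = x" "\<And>y. y \<in> topspace L \<Longrightarrow> f (g y) = y"
    and g_K: "\<And>y. y \<in> topspace L \<Longrightarrow> g y \<in> topspace K" and "homeomorphic_map L K g"
    using g homeomorphic_maps_map[of K L f g] unfolding homeomorphic_maps_def continuous_map_def
    by auto
  have n_K: "n a b c \<in> topspace K" if "a \<in> topspace K" "b \<in> topspace K" "c \<in> topspace K" for a b c
    using K that unfolding median_compactification_def topological_median_algebra_def
      median_algebra_def by blast
  have "g (p a b c) = n (g a) (g b) (g c)"
    if "a \<in> topspace L" "b \<in> topspace L" "c \<in> topspace L" for a b c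
  proof -
    have "f (n (g a) (g b) (g c)) = p a b c"
      using f(2) that g_K g_inv(2) by (simp add: median_preserving_def)
    thus ?thesis
      using g_inv(1)[OF n_K] g_K that by metis
  qed
  hence "median_preserving (topspace L) p n g"
    by (simp add: median_preserving_def)
  moreover have "g (\<theta> x) = \<eta> x" if "x \<in> topspace T" for x
  proof -
    have "\<eta> x \<in> topspace K"
      using K that unfolding median_compactification_def continuous_map_def by blast
    thus ?thesis
      using g_inv(1) f(3)[OF that] by metis
  qed
  ultimately show ?thesis
    using \<open>homeomorphic_map L K g\<close> K L unfolding isomorphic_compactifications_def by blast
qed

lemma isomorphic_compactifications_trans:
  assumes "isomorphic_compactifications T m K n \<eta> L p \<theta>"
    and "isomorphic_compactifications T m L p \<theta> M q \<zeta>"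
  shows "isomorphic_compactifications T m K n \<eta> M q \<zeta>"
proof -
  obtain f where f: "homeomorphic_map K L f" "median_preserving (topspace K) n p f"
    "\<forall>x\<in>topspace T. f (\<eta> x) = \<theta> x"
    using assms(1) unfolding isomorphic_compactifications_def by blast
  obtain g where g: "homeomorphic_map L M g" "median_preserving (topspace L) p q g"
    "\<forall>x\<in>topspace T. g (\<theta> x) = \<zeta> x"
    using assms(2) unfolding isomorphic_compactifications_def by blast
  have "f a \<in> topspace L" if "a \<in> topspace K" for a
    using homeomorphic_imp_surjective_map[OF f(1)] that by blast
  hence "median_preserving (topspace K) n q (g \<circ> f)"
    using f(2) g(2) by (simp add: median_preserving_def)
  moreover have "homeomorphic_map K M (g \<circ> f)"
    using f(1) g(1) by (rule homeomorphic_map_compose)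
  moreover have "\<forall>x\<in>topspace T. (g \<circ> f) (\<eta> x) = \<zeta> x"
    using f(3) g(3) by simp
  ultimately show ?thesis
    using assms unfolding isomorphic_compactifications_def by blast
qed

text \<open>The median axioms on \<open>K\<close> are inherited through the injective homomorphism \<open>f\<close>, and the topological
  conditions through the homeomorphism \<open>f\<close>.\<close>

lemma proper_median_compactification_transfer:
  assumes L: "proper_median_compactification T m L p \<theta>"
    and f: "homeomorphic_map K L f" "median_preserving (topspace K) n p f"
    and n: "continuous_ternary K n"
    and \<eta>: "\<And>x. x \<in> topspace T \<Longrightarrow> \<eta> x \<in> topspace K \<and> f (\<eta> x) = \<theta> x"
  shows "proper_median_compactification T m K n \<eta>"
    and "isomorphic_compactifications T m K n \<eta> L p \<theta>"
proof -
  have L': "topological_median_algebra T m" "topological_median_algebra L p" "compact_space L"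
    "Hausdorff_space L" "continuous_map T L \<theta>" "median_preserving (topspace T) m p \<theta>"
    "L closure_of (\<theta> ` topspace T) = topspace L" "embedding_map T L \<theta>"
    using L unfolding proper_median_compactification_def median_compactification_def by auto
  obtain g where g: "homeomorphic_maps K L f g"
    using f(1) by (meson homeomorphic_map_maps)
  have g_inv: "\<And>x. x \<in> topspace K \<Longrightarrow> g (f x) = x" and "homeomorphic_map L K g"
    using g homeomorphic_maps_map[of K L f g] unfolding homeomorphic_maps_def by auto
  have g_\<theta>: "(g \<circ> \<theta>) x = \<eta> x" if "x \<in> topspace T" for x
    using g_inv[of "\<eta> x"] \<eta>[OF that] by simp
  have inj: "inj_on f (topspace K)" and surj: "f ` topspace K = topspace L"
    using f(1) by (simp_all add: homeomorphic_eq_everything_map)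
  have n_K: "n a b c \<in> topspace K" if "a \<in> topspace K" "b \<in> topspace K" "c \<in> topspace K" for a b c
    using that continuous_map_median_of[OF n that(1,2)] unfolding continuous_map_def by blast
  have "median_algebra (topspace L) p"
    using L'(2) by (simp add: topological_median_algebra_def)
  hence "topological_median_algebra K n"
    using median_algebra_transfer[OF _ inj _ n_K f(2)] surj n
    unfolding topological_median_algebra_def by blast
  moreover have "K homeomorphic_space L"
    using f(1) homeomorphic_map_imp_homeomorphic_space by blast
  moreover have emb: "embedding_map T K \<eta>"
  proof (rule embedding_map_eq)
    show "embedding_map T K (g \<circ> \<theta>)"
      using L'(8) \<open>homeomorphic_map L K g\<close> surjective_embedding_map[of L K g]
      by (intro embedding_map_compose) auto
  qed (rule g_\<theta>)
  moreover have "continuous_map T K \<eta>"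
    using emb homeomorphic_imp_continuous_map[of T "subtopology K (\<eta> ` topspace T)" \<eta>]
    unfolding embedding_map_def continuous_map_in_subtopology by simp
  moreover have "median_preserving (topspace T) m n \<eta>"
    unfolding median_preserving_def
  proof (intro ballI)
    fix a b c assume abc: "a \<in> topspace T" "b \<in> topspace T" "c \<in> topspace T"
    have "m a b c \<in> topspace T"
      using L'(1) abc unfolding topological_median_algebra_def median_algebra_def by blast
    hence "f (\<eta> (m a b c)) = f (n (\<eta> a) (\<eta> b) (\<eta> c))" "\<eta> (m a b c) \<in> topspace K"
      using abc \<eta> L'(6) f(2) by (simp_all add: median_preserving_def)
    thus "\<eta> (m a b c) = n (\<eta> a) (\<eta> b) (\<eta> c)"
      using inj n_K \<eta> abc by (meson inj_onD)
  qed
  moreover have "K closure_of (\<eta> ` topspace T) = topspace K"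
  proof -
    have "\<eta> ` topspace T = g ` \<theta> ` topspace T"
      using g_\<theta> by (force simp: image_iff)
    moreover have "\<theta> ` topspace T \<subseteq> topspace L"
      using L'(5) unfolding continuous_map_def by blast
    ultimately show ?thesis
      using homeomorphic_map_dense_image[OF \<open>homeomorphic_map L K g\<close> L'(7)] by simp
  qed
  ultimately show *: "proper_median_compactification T m K n \<eta>"
    using L' homeomorphic_compact_space homeomorphic_Hausdorff_space
    unfolding proper_median_compactification_def median_compactification_def by blast
  show "isomorphic_compactifications T m K n \<eta> L p \<theta>"
    using * L f \<eta> unfolding isomorphic_compactifications_def proper_median_compactification_def
    by blast
qed

section \<open>The median uniformity and halfspaces\<close>

lemma halfspaces_subset_Pow: "halfspaces X m \<subseteq> Pow X"
  using halfspaceD(1) by blast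

lemma refines_trans:
  assumes "refines A B" "refines B C"
  shows "refines A C"
  unfolding refines_def
proof
  fix a assume "a \<in> A"
  then obtain b where "b \<in> B" "a \<subseteq> b"
    using assms(1) unfolding refines_def by blast
  moreover from this obtain c where "c \<in> C" "b \<subseteq> c"
    using assms(2) unfolding refines_def by blast
  ultimately show "\<exists>c\<in>C. a \<subseteq> c" by blast
qed

lemma uniformity_from_subbase_mono:
  assumes "\<And>C. C \<in> B \<Longrightarrow> \<exists>C'\<in>B'. refines C' C"
  shows "uniformity_from_subbase X B \<subseteq> uniformity_from_subbase X B'"
proof
  fix C assume "C \<in> uniformity_from_subbase X B"
  then obtain S where S: "is_cover X C" "finite S" "S \<subseteq> B" "refines (common_refinement X S) C"
    unfolding uniformity_from_subbase_def by blast
  have "\<forall>C\<in>S. \<exists>C'. C' \<in> B' \<and> refines C' C"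
    using assms S(3) by blast
  from bchoice[OF this] obtain g where g: "\<forall>C\<in>S. g C \<in> B' \<and> refines (g C) C"
    by blast
  have "refines (common_refinement X (g ` S)) (common_refinement X S)"
    unfolding refines_def
  proof
    fix d assume "d \<in> common_refinement X (g ` S)"
    then obtain f where f: "d = X \<inter> (\<Inter>C\<in>g ` S. f C)" "\<forall>C\<in>g ` S. f C \<in> C"
      unfolding common_refinement_def by blast
    have "\<exists>c. c \<in> C \<and> f (g C) \<subseteq> c" if "C \<in> S" for C
    proof -
      have "f (g C) \<in> g C" "refines (g C) C"
        using f(2) g that by simp_all
      thus ?thesis
        unfolding refines_def by blast
    qed
    hence "\<forall>C\<in>S. \<exists>c. c \<in> C \<and> f (g C) \<subseteq> c" by blast
    from bchoice[OF this] obtain h where h: "\<forall>C\<in>S. h C \<in> C \<and> f (g C) \<subseteq> h C"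
      by blast
    have "d \<subseteq> X \<inter> (\<Inter>C\<in>S. h C)"
      using f(1) h by blast
    thus "\<exists>c\<in>common_refinement X S. d \<subseteq> c"
      using h unfolding common_refinement_def by blast
  qed
  hence "refines (common_refinement X (g ` S)) C"
    using S(4) by (rule refines_trans)
  moreover have "finite (g ` S)" "g ` S \<subseteq> B'"
    using S(2) g by auto
  ultimately show "C \<in> uniformity_from_subbase X B'"
    using S(1) unfolding uniformity_from_subbase_def by blast
qed

lemma adjacent_chain:
  assumes M: "median_algebra X m" and "adjacent X m u v"
  shows "median_chain X m (median_interval X m u v)"
proof -
  have uv: "u \<in> X" "v \<in> X" "u \<noteq> v" "median_interval X m u v = {u, v}"
    using assms(2) by (simp_all add: adjacent_def)
  have m: "m u u u = u" "m u u v = u" "m u v u = u" "m v u u = u"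
    "m v v v = v" "m v v u = v" "m v u v = v" "m u v v = v"
    using uv median_repeated[OF M] median_repeated'[OF M] median_repeated''[OF M] by simp_all
  define r where "r = {(u, u), (u, v), (v, v)}"
  have "linear_order_on {u, v} r"
    using uv(3) by (auto simp: r_def linear_order_on_def partial_order_on_def preorder_on_def
        refl_on_def trans_def antisym_def total_on_def)
  moreover have "median_subalgebra X m {u, v}"
    using uv m by (auto simp: median_subalgebra_def)
  moreover have "\<forall>a\<in>{u, v}. \<forall>b\<in>{u, v}. \<forall>c\<in>{u, v}. (a, b) \<in> r \<and> (b, c) \<in> r \<longrightarrow> m a b c = b"
    using uv m by (auto simp: r_def)
  ultimately show ?thesis
    unfolding median_chain_def uv(4) by blast
qed

text \<open>Let \<open>w\<close> be adjacent to \<open>v\<close> in \<open>[u,v]\<close>. Associativity gives \<open>m w x v = m (m x v u) v w\<close>, so \<open>x\<close> is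
  on the side of \<open>v\<close> if \<open>m x v u = v\<close> and on the side of \<open>w\<close> if \<open>m x v u = u\<close>. The two sides of the
  edge therefore avoid what the two branches leave out.\<close>

lemma branch_cover_refined_by_halfspace:
  assumes M: "median_algebra X m" and "algebraically_discrete X m"
    and uv: "u \<in> X" "v \<in> X" "u \<noteq> v"
  obtains H where "H \<in> halfspaces X m" "refines {H, X - H} {branch X m u v, branch X m v u}"
proof -
  obtain w where w: "w \<in> median_interval X m u v" "adjacent X m w v"
    using exists_adjacent_in_interval[OF assms] .
  hence w': "w \<in> X" "m u v w = w" "w \<noteq> v"
    by (simp_all add: median_interval_def adjacent_def)
  define H where "H = {x \<in> X. m w x v = w}"
  have key: "m w x v = m (m x v u) v w" if "x \<in> X" for x
  proof -
    have "m w x v = m x v w"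
      using median_swap12[OF M, of w x v] median_swap23[OF M, of x w v] w'(1) uv that by simp
    also have "\<dots> = m x v (m u v w)"
      using w'(2) by simp
    also have "\<dots> = m (m x v u) v w"
      using median_assoc[OF M, of x u w v] w'(1) uv that by simp
    finally show ?thesis .
  qed
  have "H \<subseteq> branch X m u v"
  proof
    fix x assume x: "x \<in> H"
    hence "x \<in> X" by (simp add: H_def)
    moreover have "m u x v \<noteq> v"
    proof
      assume "m u x v = v"
      hence "m x v u = v"
        using median_swap12[OF M, of u x v] median_swap23[OF M, of x u v] \<open>x \<in> X\<close> uv by simp
      hence "m w x v = v"
        using key[OF \<open>x \<in> X\<close>] median_repeated'[OF M] w'(1) uv by simp
      thus False
        using x w'(3) by (simp add: H_def)
    qed
    ultimately show "x \<in> branch X m u v"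
      by (simp add: branch_def)
  qed
  moreover have "X - H \<subseteq> branch X m v u"
  proof
    fix x assume x: "x \<in> X - H"
    hence "x \<in> X" by simp
    moreover have "m v x u \<noteq> u"
    proof
      assume "m v x u = u"
      hence "m w x v = w"
        using key[OF \<open>x \<in> X\<close>] median_swap12[OF M, of v x u] w'(2) \<open>x \<in> X\<close> uv by simp
      thus False
        using x by (simp add: H_def)
    qed
    ultimately show "x \<in> branch X m v u"
      by (simp add: branch_def)
  qed
  ultimately have "refines {H, X - H} {branch X m u v, branch X m v u}"
    by (simp add: refines_def)
  thus thesis
    using that adjacent_halfspace[OF M w(2)] by (simp add: H_def)
qed

text \<open>The partitions by halfspaces refine the branch covers, and conversely the partition by a halfspace
  is the branch cover of an adjacent pair, whose interval is a two-point chain.\<close>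

theorem median_uniformity_halfspaces:
  assumes M: "median_algebra X m" and discrete: "algebraically_discrete X m"
  shows "median_uniformity X m = partition_uniformity X (halfspaces X m)"
proof -
  let ?B = "{{branch X m u v, branch X m v u} | u v.
    u \<in> X \<and> v \<in> X \<and> u \<noteq> v \<and> median_chain X m (median_interval X m u v)}"
  have "\<exists>C'\<in>two_set_partitions X (halfspaces X m). refines C' C" if C: "C \<in> ?B" for C
  proof -
    obtain u v where uv: "C = {branch X m u v, branch X m v u}" "u \<in> X" "v \<in> X" "u \<noteq> v"
      using C by blast
    obtain H where "H \<in> halfspaces X m" "refines {H, X - H} C"
      using branch_cover_refined_by_halfspace[OF assms uv(2-4)] uv(1) by metis
    thus ?thesis by blast
  qed
  moreover have "\<exists>C'\<in>?B. refines C' C" if "C \<in> two_set_partitions X (halfspaces X m)" for C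
  proof -
    obtain H where H: "H \<in> halfspaces X m" "C = {H, X - H}"
      using \<open>C \<in> two_set_partitions X (halfspaces X m)\<close> by blast
    obtain u v where uv: "adjacent X m u v" "H = {x \<in> X. m u x v = u}"
      using halfspace_from_adjacent[OF assms H(1)] .
    have X: "u \<in> X" "v \<in> X" "u \<noteq> v"
      using uv(1) by (simp_all add: adjacent_def)
    have "m u x v = u \<longleftrightarrow> m u x v \<noteq> v" "m v x u = m u x v" if "x \<in> X" for x
      using median_mem_interval[OF M X(1,2) that] uv(1) median_swap13[OF M X(2) that X(1)]
      by (auto simp: adjacent_def)
    hence "branch X m u v = H" "branch X m v u = X - H"
      unfolding branch_def uv(2) by auto
    hence "C \<in> ?B"
      using H(2) X adjacent_chain[OF M uv(1)] by blast
    thus ?thesis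
      unfolding refines_def by blast
  qed
  ultimately show ?thesis
    unfolding median_uniformity_def by (intro equalityI uniformity_from_subbase_mono)
qed

section \<open>The Roller compactification\<close>

lemma roller_cube_membership: "roller_cube X m = membership_cube (halfspaces X m)"
  by (simp add: roller_cube_def membership_cube_def)

lemma roller_map_membership: "roller_map X m = membership_map (halfspaces X m)"
  by (simp add: roller_map_def membership_map_def fun_eq_iff)

lemma topspace_roller_space:
  "topspace (roller_space X m) = roller_cube X m closure_of (roller_map X m ` X)"
  using closure_of_subset_topspace[of "roller_cube X m"] by (auto simp: roller_space_def)

lemma median_topology_pullback:
  assumes "median_algebra X m" "algebraically_discrete X m"
  shows "median_topology X m = pullback_topology X (roller_map X m) (roller_cube X m)"
  unfolding median_topology_def median_uniformity_halfspaces[OF assms] roller_cube_membership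
    roller_map_membership by (rule uniform_topology_partition[OF halfspaces_subset_Pow])

lemma topspace_median_topology:
  assumes "median_algebra X m" "algebraically_discrete X m"
  shows "topspace (median_topology X m) = X"
  unfolding median_topology_pullback[OF assms] topspace_pullback_topology
  using membership_map_in_cube by (auto simp: roller_cube_membership roller_map_membership)

lemma inj_on_roller_map:
  assumes "median_algebra X m" "algebraically_discrete X m"
  shows "inj_on (roller_map X m) X"
proof (rule inj_onI, rule ccontr)
  fix x y assume xy: "x \<in> X" "y \<in> X" "roller_map X m x = roller_map X m y" "x \<noteq> y"
  obtain H where H: "H \<in> halfspaces X m" "x \<in> H" "y \<notin> H"
    using halfspace_separation[OF assms xy(1,2,4)] .
  thus False
    using fun_cong[OF xy(3), of H] by (simp add: roller_map_def)
qed

text \<open>Two of the three points lie on the same side, and \<open>m x y z\<close> lies in the interval between them.\<close>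

lemma halfspace_majority:
  assumes M: "median_algebra X m" and H: "H \<in> halfspaces X m"
    and X: "x \<in> X" "y \<in> X" "z \<in> X"
  shows "m x y z \<in> H \<longleftrightarrow> majority (x \<in> H) (y \<in> H) (z \<in> H)"
proof -
  have in_interval: "m x y z \<in> median_interval X m x y" "m x y z \<in> median_interval X m y z"
    "m x y z \<in> median_interval X m x z"
    using median_mem_interval[OF M X(1,2,3)] median_mem_interval[OF M X(1,3,2)]
      median_mem_interval[OF M X(2,3,1)] median_swap23[OF M X] median_swap23[OF M X(2,1,3)]
      median_swap12[OF M X] X
    by simp_all
  have two: "m x y z \<in> G" if G: "G \<in> halfspaces X m" and
    two: "x \<in> G \<and> y \<in> G \<or> y \<in> G \<and> z \<in> G \<or> x \<in> G \<and> z \<in> G" for G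
    using two in_interval halfspaceD(3)[OF G] by (meson subsetD)
  show ?thesis
    using two[OF H] two[OF halfspaceD(2)[OF H]] X by (auto simp: majority_def)
qed

lemma median_preserving_roller_map:
  assumes "median_algebra X m"
  shows "median_preserving X m (roller_median X m) (roller_map X m)"
  unfolding median_preserving_def roller_median_def roller_map_def
  by (intro ballI restrict_ext) (simp add: halfspace_majority[OF assms])

lemma continuous_ternary_roller_cube: "continuous_ternary (roller_cube X m) (roller_median X m)"
proof -
  let ?Q = "roller_cube X m"
  let ?Q3 = "prod_topology ?Q (prod_topology ?Q ?Q)"
  let ?b = "discrete_topology (UNIV :: bool set)"
  have proj: "continuous_map ?Q3 ?b (\<lambda>z. g z H)"
    if "continuous_map ?Q3 ?Q g" "H \<in> halfspaces X m" for g H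
    using continuous_map_compose[OF that(1)[unfolded roller_cube_def]
        continuous_map_product_projection[OF that(2)]] by (simp add: o_def roller_cube_def)
  have maj: "continuous_map (prod_topology ?b (prod_topology ?b ?b)) ?b
      (\<lambda>(a, b, c). majority a b c)"
    by (simp flip: prod_topology_discrete_topology)
  have "continuous_map ?Q3 ?b (\<lambda>z. majority (fst z H) (fst (snd z) H) (snd (snd z) H))"
    if H: "H \<in> halfspaces X m" for H
    using continuous_map_compose[OF _ maj,
        of ?Q3 "\<lambda>z. (fst z H, fst (snd z) H, snd (snd z) H)"]
      continuous_map_triple_projections[of ?Q, THEN proj, OF H]
    by (simp add: continuous_map_pairwise o_def)
  hence "continuous_map ?Q3 ?Q
      (\<lambda>z. \<lambda>H\<in>halfspaces X m. majority (fst z H) (fst (snd z) H) (snd (snd z) H))"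
    unfolding roller_cube_def[of X m] continuous_map_componentwise by auto
  thus ?thesis
    by (simp add: continuous_ternary_def roller_median_def case_prod_unfold)
qed

lemma roller_median_in_space:
  assumes M: "median_algebra X m"
    and "p \<in> topspace (roller_space X m)" "q \<in> topspace (roller_space X m)"
      "r \<in> topspace (roller_space X m)"
  shows "roller_median X m p q r \<in> topspace (roller_space X m)"
proof -
  let ?Q = "roller_cube X m"
  let ?D = "roller_map X m ` X"
  let ?f = "\<lambda>(p, q, r). roller_median X m p q r"
  have "?f ` (prod_topology ?Q (prod_topology ?Q ?Q) closure_of (?D \<times> ?D \<times> ?D)) \<subseteq>
      ?Q closure_of (?f ` (?D \<times> ?D \<times> ?D))"
    using continuous_ternary_roller_cube[of X m] unfolding continuous_ternary_def
    by (rule continuous_map_image_closure_subset)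
  moreover have "?f ` (?D \<times> ?D \<times> ?D) \<subseteq> ?D"
  proof -
    have "roller_median X m (roller_map X m a) (roller_map X m b) (roller_map X m c) \<in> ?D"
      if "a \<in> X" "b \<in> X" "c \<in> X" for a b c
      using median_preserving_roller_map[OF M] median_closed[OF M that] that
      unfolding median_preserving_def by (metis imageI)
    thus ?thesis by auto
  qed
  ultimately have "?f ` (prod_topology ?Q (prod_topology ?Q ?Q) closure_of (?D \<times> ?D \<times> ?D)) \<subseteq>
      ?Q closure_of ?D"
    using closure_of_mono[of _ ?D ?Q] by (meson order_trans)
  moreover have "(p, q, r) \<in> prod_topology ?Q (prod_topology ?Q ?Q) closure_of (?D \<times> ?D \<times> ?D)"
    using assms by (simp add: closure_of_Times topspace_roller_space)
  ultimately show ?thesis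
    unfolding topspace_roller_space by force
qed

lemma continuous_ternary_roller_space:
  assumes "median_algebra X m"
  shows "continuous_ternary (roller_space X m) (roller_median X m)"
proof -
  let ?R = "roller_space X m"
  let ?R3 = "prod_topology ?R (prod_topology ?R ?R)"
  have sub: "continuous_map ?R3 (roller_cube X m) g" if "continuous_map ?R3 ?R g" for g
    using that unfolding roller_space_def by (simp add: continuous_map_in_subtopology)
  have "continuous_map ?R3 (roller_cube X m)
      (\<lambda>z. roller_median X m (fst z) (fst (snd z)) (snd (snd z)))"
    by (rule continuous_map_ternary[OF continuous_ternary_roller_cube])
      (rule sub, rule continuous_map_triple_projections)+
  moreover have "roller_median X m (fst z) (fst (snd z)) (snd (snd z)) \<in>
      roller_cube X m closure_of (roller_map X m ` X)" if "z \<in> topspace ?R3" for z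
    using that roller_median_in_space[OF assms] by (auto simp: topspace_roller_space)
  ultimately have "continuous_map ?R3 ?R
      (\<lambda>z. roller_median X m (fst z) (fst (snd z)) (snd (snd z)))"
    by (subst (3) roller_space_def) (auto simp: continuous_map_in_subtopology)
  thus ?thesis
    by (simp add: continuous_ternary_def case_prod_unfold)
qed

lemma median_algebra_roller_space:
  assumes "median_algebra X m"
  shows "median_algebra (topspace (roller_space X m)) (roller_median X m)"
proof -
  have "roller_median X m p q q = q" if "q \<in> topspace (roller_space X m)" for p q
  proof
    fix H
    have "q \<in> topspace (roller_cube X m)"
      using that by (simp add: topspace_roller_space in_closure_of)
    hence "q \<in> extensional (halfspaces X m)"
      by (simp add: roller_cube_membership topspace_membership_cube)
    thus "roller_median X m p q q H = q H"
      using extensional_arb[of q "halfspaces X m" H]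
      by (cases "H \<in> halfspaces X m") (auto simp: roller_median_def majority_def)
  qed
  moreover have "roller_median X m a b c = roller_median X m b a c \<and>
      roller_median X m a b c = roller_median X m a c b" for a b c
    unfolding roller_median_def by (intro conjI restrict_ext) (auto simp: majority_def)
  moreover have "roller_median X m (roller_median X m a x b) x c =
      roller_median X m a x (roller_median X m b x c)" for a b c x
    unfolding roller_median_def by (intro restrict_ext) (auto simp: majority_def)
  ultimately show ?thesis
    unfolding median_algebra_def using roller_median_in_space[OF assms] by blast
qed

lemma topological_median_algebra_median_topology:
  assumes "median_algebra X m" "algebraically_discrete X m"
  shows "topological_median_algebra (median_topology X m) m"
proof -
  let ?T = "median_topology X m"
  let ?T3 = "prod_topology ?T (prod_topology ?T ?T)"
  let ?\<iota> = "roller_map X m"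
  note top = topspace_median_topology[OF assms]
  have \<iota>: "continuous_map ?T (roller_cube X m) ?\<iota>"
    using continuous_map_pullback[OF continuous_map_id, of X ?\<iota> "roller_cube X m"]
    by (simp add: median_topology_pullback[OF assms])
  have proj: "continuous_map ?T3 (roller_cube X m) (\<lambda>z. ?\<iota> (g z))" if "continuous_map ?T3 ?T g" for g
    using continuous_map_compose[OF that \<iota>] by (simp add: o_def)
  have "continuous_map ?T3 (roller_cube X m)
      (\<lambda>z. roller_median X m (?\<iota> (fst z)) (?\<iota> (fst (snd z))) (?\<iota> (snd (snd z))))"
    by (rule continuous_map_ternary[OF continuous_ternary_roller_cube])
      (rule proj, rule continuous_map_triple_projections)+
  hence "continuous_map ?T3 (roller_cube X m) (?\<iota> \<circ> (\<lambda>(a, b, c). m a b c))"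
    by (rule continuous_map_eq)
      (use median_preserving_roller_map[OF assms(1)] top in \<open>auto simp: median_preserving_def\<close>)
  hence "continuous_map ?T3 (pullback_topology X ?\<iota> (roller_cube X m)) (\<lambda>(a, b, c). m a b c)"
    by (rule continuous_map_pullback') (use median_closed[OF assms(1)] top in auto)
  thus ?thesis
    using assms(1) top median_topology_pullback[OF assms]
    by (simp add: topological_median_algebra_def continuous_ternary_def)
qed

theorem proper_median_compactification_roller:
  assumes "median_algebra X m" "algebraically_discrete X m"
  shows "proper_median_compactification (median_topology X m) m
    (roller_space X m) (roller_median X m) (roller_map X m)"
proof -
  let ?T = "median_topology X m"
  let ?R = "roller_space X m"
  let ?Q = "roller_cube X m"
  let ?\<iota> = "roller_map X m"
  note top = topspace_median_topology[OF assms]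
  have \<iota>_Q: "?\<iota> ` X \<subseteq> topspace ?Q"
    using membership_map_in_cube by (auto simp: roller_cube_membership roller_map_membership)
  hence \<iota>_R: "?\<iota> ` X \<subseteq> ?Q closure_of (?\<iota> ` X)"
    by (rule closure_of_subset)
  have "compact_space ?Q" "Hausdorff_space ?Q"
    unfolding roller_cube_def
    by (simp_all add: compact_space_product_topology compact_space_discrete_topology
        Hausdorff_space_product_topology)
  hence R: "compact_space ?R" "Hausdorff_space ?R"
    unfolding roller_space_def
    by (simp_all add: compact_space_subtopology closedin_compact_space Hausdorff_space_subtopology)
  have "embedding_map ?T ?Q ?\<iota>"
    using homeomorphic_map_pullback_image[OF inj_on_roller_map[OF assms] \<iota>_Q]
    unfolding embedding_map_def top unfolding median_topology_pullback[OF assms] .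
  hence emb: "embedding_map ?T ?R ?\<iota>"
    unfolding roller_space_def embedding_map_in_subtopology using \<iota>_R top by simp
  moreover have "continuous_map ?T ?R ?\<iota>"
    using emb homeomorphic_imp_continuous_map[of ?T "subtopology ?R (?\<iota> ` topspace ?T)" ?\<iota>]
    unfolding embedding_map_def continuous_map_in_subtopology by simp
  moreover have "?R closure_of (?\<iota> ` topspace ?T) = topspace ?R"
    unfolding roller_space_def top closure_of_subtopology using \<iota>_R closure_of_subset_topspace[of ?Q]
    by (simp add: Int_absorb1 Int_absorb2)
  ultimately show ?thesis
    using topological_median_algebra_median_topology[OF assms] R top
      median_algebra_roller_space[OF assms(1)] continuous_ternary_roller_space[OF assms(1)]
      median_preserving_roller_map[OF assms(1)]
    by (simp add: proper_median_compactification_def median_compactification_def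
        topological_median_algebra_def)
qed

section \<open>Uniqueness of the proper compactification\<close>

text \<open>Halfspaces survive in the compactification as clopen sets. If \<open>u\<close> and \<open>v\<close> are adjacent across the
  boundary of \<open>H\<close>, the continuous map \<open>k \<mapsto> n (\<eta> u) (\<eta> v) k\<close> takes only the values \<open>\<eta> u\<close> and \<open>\<eta> v\<close>
  on the dense image of \<open>X\<close>, the first on \<open>\<eta> ` H\<close> and the second on \<open>\<eta> ` (X - H)\<close>, and its two fibres
  are closed and disjoint.\<close>

lemma closure_of_halfspace_complement:
  assumes M: "median_algebra X m" and discrete: "algebraically_discrete X m"
    and H: "H \<in> halfspaces X m"
    and n: "continuous_ternary K n" and K: "Hausdorff_space K"
    and \<eta>: "\<eta> ` X \<subseteq> topspace K" "inj_on \<eta> X" "median_preserving X m n \<eta>"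
    and dense: "K closure_of (\<eta> ` X) = topspace K"
  shows "K closure_of (\<eta> ` (X - H)) = topspace K - K closure_of (\<eta> ` H)"
proof -
  obtain u v where adj: "adjacent X m u v" and H_eq: "H = {x \<in> X. m u x v = u}"
    using halfspace_from_adjacent[OF M discrete H] .
  have uv: "u \<in> X" "v \<in> X" "u \<noteq> v"
    using adj by (simp_all add: adjacent_def)
  have \<eta>_uv: "\<eta> u \<in> topspace K" "\<eta> v \<in> topspace K" "\<eta> u \<noteq> \<eta> v"
    using \<eta>(1,2) uv by (auto dest: inj_onD)
  define E where "E w = {k \<in> topspace K. n (\<eta> u) (\<eta> v) k = \<eta> w}" for w
  have closed: "closedin K (E w)" if "\<eta> w \<in> topspace K" for w
    unfolding E_def
    by (rule closedin_continuous_maps_eq[OF K continuous_map_median_of[OF n \<eta>_uv(1,2)]])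
      (simp add: that)
  have in_E: "\<eta> x \<in> E (m u x v)" if "x \<in> X" for x
    using \<eta>(1,3) uv that median_swap23[OF M uv(1,2) that]
    by (auto simp: E_def median_preserving_def simp flip: median_swap23[OF M uv(1,2) that])
  have "\<eta> ` H \<subseteq> E u"
    using in_E H_eq by force
  hence sub_u: "K closure_of (\<eta> ` H) \<subseteq> E u"
    using closed \<eta>_uv by (simp add: closure_of_minimal)
  have "m u x v = v" if "x \<in> X - H" for x
    using that median_mem_interval[OF M uv(1,2), of x] adj by (auto simp: H_eq adjacent_def)
  hence "\<eta> ` (X - H) \<subseteq> E v"
    using in_E by force
  hence sub_v: "K closure_of (\<eta> ` (X - H)) \<subseteq> E v"
    using closed \<eta>_uv by (simp add: closure_of_minimal)
  have "E u \<inter> E v = {}"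
    using \<eta>_uv by (auto simp: E_def)
  moreover have "K closure_of (\<eta> ` H) \<union> K closure_of (\<eta> ` (X - H)) = topspace K"
  proof -
    have "\<eta> ` X = \<eta> ` H \<union> \<eta> ` (X - H)"
      using halfspaceD(1)[OF H] by blast
    thus ?thesis
      using dense closure_of_Un[of K] by metis
  qed
  ultimately show ?thesis
    using sub_u sub_v by blast
qed

lemma continuous_map_clopen_membership:
  assumes "closedin K C" "closedin K (topspace K - C)"
  shows "continuous_map K (discrete_topology UNIV) (\<lambda>k. k \<in> C)"
proof -
  have "openin K C" "openin K (topspace K - C)"
    using assms closedin_subset[OF assms(1)] by (auto simp: openin_closedin_eq)
  moreover have "{k \<in> topspace K. (k \<in> C) \<in> U} =
      (if True \<in> U then C else {}) \<union> (if False \<in> U then topspace K - C else {})" for U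
    using closedin_subset[OF assms(1)]
    by (cases "True \<in> U"; cases "False \<in> U") (auto, (metis (full_types))+)
  ultimately show ?thesis
    by (auto simp: continuous_map_def)
qed

text \<open>A point of \<open>K\<close> is sent to the family of halfspaces whose closure contains it. That this map \<open>\<phi>\<close> is a
  continuous homomorphism onto the Roller compactification follows from density; the point is
  that it is injective. Let \<open>\<phi> p = \<phi> q\<close>. For \<open>x\<close> and \<open>y\<close> in \<open>X\<close> the points \<open>n (\<eta> x) (\<eta> y) p\<close> and
  \<open>n (\<eta> x) (\<eta> y) q\<close> lie in \<open>\<eta> ` [x,y]\<close>, which is closed because it is finite, so they come from
  \<open>X\<close>, where halfspaces separate points; hence they are equal. By density \<open>n a b p = n a b q\<close> for all \<open>a\<close> and
  \<open>b\<close> in \<open>K\<close>, and \<open>a = p\<close>, \<open>b = q\<close> gives \<open>p = q\<close>.\<close>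

theorem proper_median_compactification_unique:
  assumes M: "median_algebra X m" and discrete: "algebraically_discrete X m"
    and proper: "proper_median_compactification (median_topology X m) m K n \<eta>"
  shows "isomorphic_compactifications (median_topology X m) m K n \<eta>
    (roller_space X m) (roller_median X m) (roller_map X m)"
proof -
  let ?R = "roller_space X m"
  let ?Q = "roller_cube X m"
  let ?\<iota> = "roller_map X m"
  note top = topspace_median_topology[OF M discrete]
  have K: "median_algebra (topspace K) n" "continuous_ternary K n" "compact_space K"
    "Hausdorff_space K" and \<eta>_cont: "continuous_map (median_topology X m) K \<eta>"
    and \<eta>_hom: "median_preserving X m n \<eta>" and dense: "K closure_of (\<eta> ` X) = topspace K"
    and \<eta>_emb: "embedding_map (median_topology X m) K \<eta>"
    using proper unfolding proper_median_compactification_def median_compactification_def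
      topological_median_algebra_def top by auto
  have \<eta>_K: "\<eta> ` X \<subseteq> topspace K"
    using \<eta>_cont top unfolding continuous_map_def by auto
  have \<eta>_inj: "inj_on \<eta> X"
    using \<eta>_emb top unfolding embedding_map_def homeomorphic_eq_everything_map by simp
  have \<eta>_n: "n (\<eta> x) (\<eta> y) (\<eta> z) = \<eta> (m x y z)" if "x \<in> X" "y \<in> X" "z \<in> X" for x y z
    using \<eta>_hom that by (simp add: median_preserving_def)
  define \<phi> where "\<phi> k = (\<lambda>H\<in>halfspaces X m. k \<in> K closure_of (\<eta> ` H))" for k
  have compl: "K closure_of (\<eta> ` (X - H)) = topspace K - K closure_of (\<eta> ` H)"
    if "H \<in> halfspaces X m" for H
    using closure_of_halfspace_complement[OF M discrete that K(2,4) \<eta>_K \<eta>_inj \<eta>_hom dense] .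
  have "continuous_map K (discrete_topology UNIV) (\<lambda>k. \<phi> k H)" if "H \<in> halfspaces X m" for H
  proof -
    have "closedin K (topspace K - K closure_of (\<eta> ` H))"
      unfolding compl[OF that, symmetric] by simp
    thus ?thesis
      using continuous_map_clopen_membership[of K "K closure_of (\<eta> ` H)"] that
      by (simp add: \<phi>_def)
  qed
  hence \<phi>_cont: "continuous_map K ?Q \<phi>"
    unfolding roller_cube_def continuous_map_componentwise by (auto simp: \<phi>_def)
  have \<phi>_\<eta>: "\<phi> (\<eta> x) = ?\<iota> x" if x: "x \<in> X" for x
    unfolding \<phi>_def roller_map_def
  proof (rule restrict_ext)
    fix H assume H: "H \<in> halfspaces X m"
    have "\<eta> x \<in> K closure_of (\<eta> ` G)" if "x \<in> G" "G \<subseteq> X" for G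
      using that \<eta>_K closure_of_subset[of "\<eta> ` G" K] by blast
    from this[of H] this[of "X - H"] show "(\<eta> x \<in> K closure_of (\<eta> ` H)) = (x \<in> H)"
      using compl[OF H] x halfspaceD(1)[OF H] by blast
  qed
  have \<phi>_image_\<eta>: "\<phi> ` \<eta> ` X = ?\<iota> ` X"
    using \<phi>_\<eta> by (force simp: image_iff)
  have \<phi>_surj: "\<phi> ` topspace K = topspace ?R"
  proof
    show "\<phi> ` topspace K \<subseteq> topspace ?R"
      using continuous_map_image_closure_subset[OF \<phi>_cont, of "\<eta> ` X"]
      unfolding dense \<phi>_image_\<eta> topspace_roller_space .
    have "compactin ?Q (\<phi> ` topspace K)"
      using K(3) \<phi>_cont image_compactin unfolding compact_space_def by blast
    moreover have "Hausdorff_space ?Q"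
      unfolding roller_cube_def by (simp add: Hausdorff_space_product_topology)
    ultimately have "closedin ?Q (\<phi> ` topspace K)"
      using compactin_imp_closedin by blast
    moreover have "?\<iota> ` X \<subseteq> \<phi> ` topspace K"
      unfolding \<phi>_image_\<eta>[symmetric] using \<eta>_K by blast
    ultimately show "topspace ?R \<subseteq> \<phi> ` topspace K"
      unfolding topspace_roller_space by (simp add: closure_of_minimal)
  qed
  have \<phi>_R: "continuous_map K ?R \<phi>"
    using \<phi>_cont \<phi>_surj unfolding topspace_roller_space
    by (auto simp: roller_space_def continuous_map_in_subtopology)
  have R: "Hausdorff_space ?R"
    using proper_median_compactification_roller[OF M discrete]
    unfolding proper_median_compactification_def median_compactification_def by blast
  have \<phi>_hom: "median_preserving (topspace K) n (roller_median X m) \<phi>"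
  proof (rule median_preserving_from_dense[OF K(2) continuous_ternary_roller_space[OF M] R \<phi>_R dense])
    fix a b c assume "a \<in> \<eta> ` X" "b \<in> \<eta> ` X" "c \<in> \<eta> ` X"
    then obtain x y z where xyz: "x \<in> X" "y \<in> X" "z \<in> X" "a = \<eta> x" "b = \<eta> y" "c = \<eta> z"
      by blast
    thus "\<phi> (n a b c) = roller_median X m (\<phi> a) (\<phi> b) (\<phi> c)"
      using \<eta>_n \<phi>_\<eta> median_closed[OF M xyz(1-3)] median_preserving_roller_map[OF M]
      by (simp add: median_preserving_def)
  qed
  have interval: "n (\<eta> x) (\<eta> y) k \<in> \<eta> ` X" if xy: "x \<in> X" "y \<in> X" and k: "k \<in> topspace K" for x y k
  proof -
    let ?F = "\<eta> ` median_interval X m x y"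
    have "finite ?F" "?F \<subseteq> topspace K"
      using discrete xy \<eta>_K by (auto simp: algebraically_discrete_def median_interval_def)
    hence "closedin K ?F"
      using K(4) closedin_Hausdorff_finite by blast
    moreover have "continuous_map K K (n (\<eta> x) (\<eta> y))"
      using continuous_map_median_of[OF K(2)] xy \<eta>_K by blast
    ultimately have "closedin K {k \<in> topspace K. n (\<eta> x) (\<eta> y) k \<in> ?F}"
      by (intro closedin_continuous_map_preimage)
    moreover have "n (\<eta> x) (\<eta> y) k \<in> ?F" if k: "k \<in> \<eta> ` X" for k
    proof -
      obtain z where "z \<in> X" "k = \<eta> z"
        using k by blast
      moreover from this have "m x y z \<in> median_interval X m x y"
        using median_mem_interval[OF M xy, of z] median_swap23[OF M xy, of z] by simp
      ultimately show ?thesis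
        using \<eta>_n xy by simp
    qed
    moreover have "k \<in> K closure_of (\<eta> ` X)"
      using k dense by simp
    ultimately have "n (\<eta> x) (\<eta> y) k \<in> ?F"
      using forall_in_closure_of[of k K "\<eta> ` X" "\<lambda>k. n (\<eta> x) (\<eta> y) k \<in> ?F"] by blast
    thus ?thesis
      by (auto simp: median_interval_def)
  qed
  have "inj_on \<phi> (topspace K)"
  proof (rule inj_onI)
    fix p q assume p: "p \<in> topspace K" and q: "q \<in> topspace K" and eq: "\<phi> p = \<phi> q"
    have on_X: "n (\<eta> x) (\<eta> y) p = n (\<eta> x) (\<eta> y) q" if xy: "x \<in> X" "y \<in> X" for x y
    proof -
      obtain z w where zw: "z \<in> X" "w \<in> X" "n (\<eta> x) (\<eta> y) p = \<eta> z" "n (\<eta> x) (\<eta> y) q = \<eta> w"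
        using interval[OF xy p] interval[OF xy q] by blast
      have "\<phi> (n (\<eta> x) (\<eta> y) p) = \<phi> (n (\<eta> x) (\<eta> y) q)"
        using \<phi>_hom xy \<eta>_K p q eq by (simp add: median_preserving_def image_subset_iff)
      hence "?\<iota> z = ?\<iota> w"
        using zw \<phi>_\<eta> by simp
      thus ?thesis
        using zw inj_onD[OF inj_on_roller_map[OF M discrete]] by metis
    qed
    have cont: "continuous_map K K (\<lambda>k. n a k c)" "continuous_map K K (\<lambda>k. n k a c)"
      if "a \<in> topspace K" "c \<in> topspace K" for a c
      using continuous_map_ternary[OF K(2), of K "\<lambda>_. a" id "\<lambda>_. c"]
        continuous_map_ternary[OF K(2), of K id "\<lambda>_. a" "\<lambda>_. c"] that by simp_all
    have on_one: "n (\<eta> x) b p = n (\<eta> x) b q" if x: "x \<in> X" and b: "b \<in> topspace K" for x b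
    proof (rule forall_in_closure_of_eq[of b K "\<eta> ` X" K])
      show "continuous_map K K (\<lambda>b. n (\<eta> x) b p)" "continuous_map K K (\<lambda>b. n (\<eta> x) b q)"
        using cont x \<eta>_K p q by blast+
    qed (use b dense K(4) on_X x in auto)
    have "n a b p = n a b q" if a: "a \<in> topspace K" and b: "b \<in> topspace K" for a b
    proof (rule forall_in_closure_of_eq[of a K "\<eta> ` X" K])
      show "continuous_map K K (\<lambda>a. n a b p)" "continuous_map K K (\<lambda>a. n a b q)"
        using cont b p q by blast+
    qed (use a b dense K(4) on_one in auto)
    from this[OF p q] show "p = q"
      using median_repeated''[OF K(1) p q] median_repeated[OF K(1) p q] by simp
  qed
  hence "homeomorphic_map K ?R \<phi>"
    using continuous_imp_homeomorphic_map[OF \<phi>_R K(3) R \<phi>_surj] by blast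
  thus ?thesis
    using \<phi>_hom \<phi>_\<eta> top proper proper_median_compactification_roller[OF M discrete]
    unfolding isomorphic_compactifications_def proper_median_compactification_def by blast
qed

section \<open>The minimal median compactification\<close>

text \<open>The homeomorphism with the Roller compactification comes from the general computation of the
  completion. Pulling back the Roller median along it shows that a continuous extension of \<open>m\<close>
  exists, and by density the chosen extension corresponds to the Roller median.\<close>

theorem mmc_isomorphic_roller:
  assumes M: "median_algebra X m" and discrete: "algebraically_discrete X m"
  shows "proper_median_compactification (median_topology X m) m
      (mmc_space X m) (mmc_median X m) (mmc_map X m)"
    and "isomorphic_compactifications (median_topology X m) m
      (mmc_space X m) (mmc_median X m) (mmc_map X m)
      (roller_space X m) (roller_median X m) (roller_map X m)"
proof -
  let ?T = "median_topology X m"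
  let ?R = "roller_space X m"
  let ?K = "mmc_space X m"
  let ?K3 = "prod_topology ?K (prod_topology ?K ?K)"
  let ?\<Phi> = "filter_membership (halfspaces X m)"
  note top = topspace_median_topology[OF M discrete]
  note roller = proper_median_compactification_roller[OF M discrete]
  note Pow = halfspaces_subset_Pow[of X m]
  have \<Phi>: "homeomorphic_map ?K ?R ?\<Phi>"
    using completion_space_partition_homeomorphic[OF Pow]
    unfolding mmc_space_def median_uniformity_halfspaces[OF M discrete] roller_space_def
      roller_cube_membership roller_map_membership .
  have \<eta>: "mmc_map X m x \<in> topspace ?K \<and> ?\<Phi> (mmc_map X m x) = roller_map X m x" if "x \<in> X" for x
    using completion_map_partition[OF Pow that] filter_membership_in_cube
    unfolding mmc_map_def mmc_space_def median_uniformity_halfspaces[OF M discrete]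
      roller_map_membership completion_space_partition[OF Pow] topspace_pullback_topology by blast
  obtain g where g: "homeomorphic_maps ?K ?R ?\<Phi> g"
    using \<Phi> by (meson homeomorphic_map_maps)
  have g_inv: "\<And>x. x \<in> topspace ?K \<Longrightarrow> g (?\<Phi> x) = x" and g_cont: "continuous_map ?R ?K g"
    and g_homeo: "homeomorphic_map ?R ?K g"
    using g homeomorphic_maps_map[of ?K ?R ?\<Phi> g] unfolding homeomorphic_maps_def by auto
  have g_\<iota>: "g (roller_map X m x) = mmc_map X m x" if "x \<in> X" for x
    using g_inv \<eta>[OF that] by metis
  have "continuous_ternary ?K (\<lambda>a b c. g (roller_median X m (?\<Phi> a) (?\<Phi> b) (?\<Phi> c)))"
  proof -
    have proj: "continuous_map ?K3 ?R (\<lambda>z. ?\<Phi> (h z))" if "continuous_map ?K3 ?K h" for h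
      using continuous_map_compose[OF that homeomorphic_imp_continuous_map[OF \<Phi>]]
      by (simp add: o_def)
    have "continuous_map ?K3 ?R
        (\<lambda>z. roller_median X m (?\<Phi> (fst z)) (?\<Phi> (fst (snd z))) (?\<Phi> (snd (snd z))))"
      by (rule continuous_map_ternary[OF continuous_ternary_roller_space[OF M]])
        (rule proj, rule continuous_map_triple_projections)+
    from continuous_map_compose[OF this g_cont] show ?thesis
      by (simp add: continuous_ternary_def case_prod_unfold o_def)
  qed
  moreover have "g (roller_median X m (?\<Phi> (mmc_map X m a)) (?\<Phi> (mmc_map X m b))
      (?\<Phi> (mmc_map X m c))) = mmc_map X m (m a b c)" if "a \<in> X" "b \<in> X" "c \<in> X" for a b c
    using \<eta> that g_\<iota> median_closed[OF M that] median_preserving_roller_map[OF M]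
    unfolding median_preserving_def by metis
  ultimately have "\<exists>N. continuous_ternary ?K N \<and> (\<forall>a\<in>X. \<forall>b\<in>X. \<forall>c\<in>X.
      N (mmc_map X m a) (mmc_map X m b) (mmc_map X m c) = mmc_map X m (m a b c))"
    by (intro exI[of _ "\<lambda>a b c. g (roller_median X m (?\<Phi> a) (?\<Phi> b) (?\<Phi> c))"]) blast
  \<comment> \<open>\<open>mmc_median\<close> is an arbitrary choice of extension; density fixes its values on the completion.\<close>
  from someI_ex[OF this] have n: "continuous_ternary ?K (mmc_median X m)"
    and n_\<eta>: "\<And>a b c. a \<in> X \<Longrightarrow> b \<in> X \<Longrightarrow> c \<in> X \<Longrightarrow>
      mmc_median X m (mmc_map X m a) (mmc_map X m b) (mmc_map X m c) = mmc_map X m (m a b c)"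
    unfolding mmc_median_def by blast+
  have R: "Hausdorff_space ?R" "?R closure_of (roller_map X m ` X) = topspace ?R"
    "roller_map X m ` X \<subseteq> topspace ?R"
    using roller top unfolding proper_median_compactification_def median_compactification_def
      continuous_map_def by auto
  have "g ` roller_map X m ` X = mmc_map X m ` X"
    using g_\<iota> by (force simp: image_iff)
  hence dense: "?K closure_of (mmc_map X m ` X) = topspace ?K"
    using homeomorphic_map_dense_image[OF g_homeo R(2,3)] by simp
  have hom: "median_preserving (topspace ?K) (mmc_median X m) (roller_median X m) ?\<Phi>"
  proof (rule median_preserving_from_dense[OF n continuous_ternary_roller_space[OF M] R(1)
        homeomorphic_imp_continuous_map[OF \<Phi>] dense])
    fix a b c assume "a \<in> mmc_map X m ` X" "b \<in> mmc_map X m ` X" "c \<in> mmc_map X m ` X"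
    then obtain x y z where xyz: "x \<in> X" "y \<in> X" "z \<in> X"
      "a = mmc_map X m x" "b = mmc_map X m y" "c = mmc_map X m z"
      by blast
    thus "?\<Phi> (mmc_median X m a b c) = roller_median X m (?\<Phi> a) (?\<Phi> b) (?\<Phi> c)"
      using n_\<eta> \<eta> median_closed[OF M xyz(1-3)] median_preserving_roller_map[OF M]
      by (simp add: median_preserving_def)
  qed
  show "proper_median_compactification ?T m ?K (mmc_median X m) (mmc_map X m)"
    "isomorphic_compactifications ?T m ?K (mmc_median X m) (mmc_map X m)
      ?R (roller_median X m) (roller_map X m)"
    using proper_median_compactification_transfer[OF roller \<Phi> hom n] \<eta> top by simp_all
qed

theorem theorem5p6:
  fixes X :: "'a set" and m :: "'a \<Rightarrow> 'a \<Rightarrow> 'a \<Rightarrow> 'a"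
  assumes "median_algebra X m"
    and "algebraically_discrete X m"
  shows "topspace (median_topology X m) = X
    \<and> topological_median_algebra (median_topology X m) m
    \<and> proper_median_compactification (median_topology X m) m
        (mmc_space X m) (mmc_median X m) (mmc_map X m)
    \<and> (\<forall>(K :: 'k topology) n \<eta>.
         proper_median_compactification (median_topology X m) m K n \<eta> \<longrightarrow>
         isomorphic_compactifications (median_topology X m) m
           (mmc_space X m) (mmc_median X m) (mmc_map X m) K n \<eta>)
    \<and> isomorphic_compactifications (median_topology X m) m
        (mmc_space X m) (mmc_median X m) (mmc_map X m)
        (roller_space X m) (roller_median X m) (roller_map X m)"
proof (intro conjI allI impI)
  show "topspace (median_topology X m) = X"
    by (rule topspace_median_topology[OF assms])
  show "topological_median_algebra (median_topology X m) m"
    by (rule topological_median_algebra_median_topology[OF assms])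
  show "proper_median_compactification (median_topology X m) m
      (mmc_space X m) (mmc_median X m) (mmc_map X m)"
    by (rule mmc_isomorphic_roller(1)[OF assms])
  show iso: "isomorphic_compactifications (median_topology X m) m
      (mmc_space X m) (mmc_median X m) (mmc_map X m)
      (roller_space X m) (roller_median X m) (roller_map X m)"
    by (rule mmc_isomorphic_roller(2)[OF assms])
  fix K :: "'k topology" and n \<eta>
  assume "proper_median_compactification (median_topology X m) m K n \<eta>"
  from proper_median_compactification_unique[OF assms this]
  show "isomorphic_compactifications (median_topology X m) m
      (mmc_space X m) (mmc_median X m) (mmc_map X m) K n \<eta>"
    using iso isomorphic_compactifications_sym isomorphic_compactifications_trans by blast
qed

end
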